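(* Let $K$ be an algebraically closed field of arbitrary characteristic, let $R=K[[x_1,\ldots,x_n]]$, and let $f=(f_1,\ldots,f_n)\in I_{n,n}$ (so $f$ is a $0$-dimensional isolated complete intersection singularity). Then $f$ is not simple if one of the following cases occurs: a) $n\ge 2$ and $\operatorname{ord}(f)\ge 3$; b) $n\ge 3$ and $\operatorname{ord}(f)=2$.
   Context: $R=K[[x_1,\ldots,x_n]]$ has maximal ideal $\mathfrak m=\langle x_1,\ldots,x_n\rangle$. For $f=(f_1,\ldots,f_m)\in R^m$, $\operatorname{ord}(f)=\min_i \operatorname{ord}(f_i)$, where $\operatorname{ord}(f_i)$ is the usual order of a power series. ICIS: let $f=(f_1,\ldots,f_m)\in R^m$ with all $f_i\in\mathfrak m$ and put $I=\langle f_1,\ldots,f_m\rangle$. $I$ defines a complete intersection if it can be generated by elements $h_1,\ldots,h_m\in\mathfrak m$ with $h_i$ a non-zero divisor of $R/\langle h_1,\ldots,h_{i-1}\rangle$ for $i=1,\ldots,m$; then the minimal number of generators is $\operatorname{mng}(I)=\dim_K I/\mathfrak mI=m$ and $\dim R/I=n-m$. Such an $f$ is an isolated complete intersection singularity (ICIS) if there is a positive integer $k$ with $\mathfrak m^k\subset I+I_m(\mathrm{Jac}(f))$, where $I_m(\mathrm{Jac}(f))$ is the ideal of $m\times m$ minors of the Jacobian matrix $(\partial f_i/\partial x_j)$. $I_{m,n}$ denotes the set of all ICIS $f\in R^m$ with $\operatorname{mng}(I)=m$. Contact equivalence: for $f,g\in I_{m,n}$, $f\sim g$ means that there are $U\in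 GL(m,R)$ and a $K$-algebra automorphism $\phi$ of $R$ with $g=U\cdot\phi(f)$ (column vectors, $\phi$ applied componentwise). Simple: for $f\in I_{m,n}$ let $\tilde T_f(Gf)=\langle f_1,\ldots,f_m\rangle R^m+\mathfrak m\langle \partial f/\partial x_1,\ldots,\partial f/\partial x_n\rangle$ and $T^{1,sec}(f)=\mathfrak m R^m/\tilde T_f(Gf)$, a finite-dimensional $K$-vector space. Let $g_1,\ldots,g_d\in K[x_1,\ldots,x_n]^m$ (with components in $\mathfrak m$) represent a set of $K$-generators of $T^{1,sec}(f)$ and put $F_{\mathbf t}=f+\sum_{i=1}^d t_ig_i$. Then $f$ is called simple if there are a finite set $\{h_1,\ldots,h_l\}\subset I_{m,n}$ and a Zariski open neighbourhood $U$ of $0$ in $K^d$ such that for each $\mathbf t\in U$ there is a $j$ with $F_{\mathbf t}\sim h_j$. *)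

theory Defs
  imports "HOL-Analysis.Analysis" "HOL-Library.Poly_Mapping" "HOL-Library.Extended_Nat"
    "HOL-Computational_Algebra.Polynomial"
begin

section \<open>The ring of formal power series in several variables\<close>

text \<open>
  The variables are indexed by a finite type \<open>'n\<close>, so \<open>('k, 'n) mps\<close> is
  \<open>K[[x\<^sub>1, \<dots>, x\<^sub>n]]\<close> with \<open>n = CARD('n)\<close>. A series is its coefficient function
  on exponent vectors.
\<close>

typedef ('k, 'n) mps = "UNIV :: (('n \<Rightarrow> nat) \<Rightarrow> 'k) set"
  morphisms mps_coeff Abs_mps by simp

setup_lifting type_definition_mps

lemma mps_eqI: "(\<And>e. mps_coeff a e = mps_coeff b e) \<Longrightarrow> a = b"
  by transfer auto

lemma finite_exponents_le: "finite {a. a \<le> (e :: 'n::finite \<Rightarrow> nat)}"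
proof -
  have "{a. a \<le> e} \<subseteq> PiE UNIV (\<lambda>i. {..e i})"
    by (auto simp: le_fun_def)
  then show ?thesis
    by (rule finite_subset) (auto intro: finite_PiE)
qed

instantiation mps :: (comm_ring_1, finite) comm_ring_1
begin

lift_definition zero_mps :: "('a, 'b) mps" is "\<lambda>_. 0" .

lift_definition one_mps :: "('a, 'b) mps" is "\<lambda>e. if e = (\<lambda>_. 0) then 1 else 0" .

lift_definition plus_mps :: "('a, 'b) mps \<Rightarrow> ('a, 'b) mps \<Rightarrow> ('a, 'b) mps"
  is "\<lambda>f g e. f e + g e" .

lift_definition minus_mps :: "('a, 'b) mps \<Rightarrow> ('a, 'b) mps \<Rightarrow> ('a, 'b) mps"
  is "\<lambda>f g e. f e - g e" .

lift_definition uminus_mps :: "('a, 'b) mps \<Rightarrow> ('a, 'b) mps"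
  is "\<lambda>f e. - f e" .

lift_definition times_mps :: "('a, 'b) mps \<Rightarrow> ('a, 'b) mps \<Rightarrow> ('a, 'b) mps"
  is "\<lambda>f g e. \<Sum>a | a \<le> e. f a * g (e - a)" .

instance
proof
  fix a b c :: "('a, 'b) mps"
  show "a * b * c = a * (b * c)"
  proof (transfer, rule ext)
    fix f g h :: "('b \<Rightarrow> nat) \<Rightarrow> 'a" and e :: "'b \<Rightarrow> nat"
    have "(\<Sum>b | b \<le> e. (\<Sum>a | a \<le> b. f a * g (b - a)) * h (e - b)) =
        (\<Sum>(b, a)\<in>(SIGMA b:{b. b \<le> e}. {a. a \<le> b}). f a * g (b - a) * h (e - b))"
      by (simp add: sum_distrib_right sum.Sigma finite_exponents_le)
    also have "\<dots> = (\<Sum>(a, c)\<in>(SIGMA a:{a. a \<le> e}. {c. c \<le> e - a}). f a * (g c * h (e - a - c)))"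
    proof (rule sum.reindex_bij_witness
        [where i = "\<lambda>(a, c). (\<lambda>i. a i + c i, a)" and j = "\<lambda>(b, a). (a, b - a)"], goal_cases)
      case (1 p)
      then show ?case by (auto simp: le_fun_def fun_eq_iff)
    next
      case (2 p)
      then show ?case by (auto simp: le_fun_def) (meson order_trans, simp add: diff_le_mono)
    next
      case (3 p)
      then show ?case by (auto simp: le_fun_def fun_eq_iff)
    next
      case (4 p)
      then show ?case
        by (auto simp: le_fun_def Nat.le_diff_conv2 add.commute)
    next
      case (5 p)
      obtain b a where p: "p = (b, a)" by force
      have "e - a - (b - a) = e - b"
        using 5 p by (auto simp: le_fun_def fun_eq_iff)
      then show ?case by (simp add: p mult.assoc)
    qed
    also have "\<dots> = (\<Sum>a | a \<le> e. f a * (\<Sum>c | c \<le> e - a. g c * h (e - a - c)))"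
      by (simp add: sum_distrib_left sum.Sigma finite_exponents_le)
    finally show "(\<Sum>b | b \<le> e. (\<Sum>a | a \<le> b. f a * g (b - a)) * h (e - b)) =
      (\<Sum>a | a \<le> e. f a * (\<Sum>c | c \<le> e - a. g c * h (e - a - c)))" .
  qed
  show "a * b = b * a"
  proof (transfer, rule ext)
    fix f g :: "('b \<Rightarrow> nat) \<Rightarrow> 'a" and e :: "'b \<Rightarrow> nat"
    have inv: "e - (e - a) = a" "e - a \<le> e" if "a \<le> e" for a
      using that by (auto simp: le_fun_def fun_eq_iff)
    show "(\<Sum>a | a \<le> e. f a * g (e - a)) = (\<Sum>a | a \<le> e. g a * f (e - a))"
      by (rule sum.reindex_bij_witness[where i = "\<lambda>a. e - a" and j = "\<lambda>a. e - a"])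
        (simp_all add: inv mult.commute)
  qed
  show "1 * a = a"
  proof (transfer, rule ext)
    fix f :: "('b \<Rightarrow> nat) \<Rightarrow> 'a" and e :: "'b \<Rightarrow> nat"
    have "(\<Sum>a | a \<le> e. (if a = (\<lambda>_. 0) then 1 else 0) * f (e - a)) =
        (\<Sum>a | a \<le> e. if a = (\<lambda>_. 0) then f (e - a) else 0)"
      by (rule sum.cong) auto
    also have "\<dots> = f e"
      by (subst sum.delta[OF finite_exponents_le]) (auto simp: le_fun_def fun_diff_def)
    finally show "(\<Sum>a | a \<le> e. (if a = (\<lambda>_. 0) then 1 else 0) * f (e - a)) = f e" .
  qed
  show "(a + b) * c = a * c + b * c"
    by transfer (simp add: fun_eq_iff distrib_right sum.distrib)
  show "(0 :: ('a, 'b) mps) \<noteq> 1"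
    by transfer (auto simp: fun_eq_iff)
qed (transfer, simp add: fun_eq_iff add_ac)+

end

lift_definition mps_const :: "'k::zero \<Rightarrow> ('k, 'n) mps"
  is "\<lambda>c e. if e = (\<lambda>_. 0) then c else 0" .

lift_definition mps_var :: "'n \<Rightarrow> ('k::zero_neq_one, 'n) mps"
  is "\<lambda>j e. if e = (\<lambda>_. 0)(j := 1) then 1 else 0" .

lift_definition mps_deriv :: "'n \<Rightarrow> ('k::semiring_1, 'n) mps \<Rightarrow> ('k, 'n) mps"
  is "\<lambda>j f e. of_nat (Suc (e j)) * f (e(j := Suc (e j)))" .

definition mps_is_poly :: "('k::zero, 'n) mps \<Rightarrow> bool" where
  "mps_is_poly a \<longleftrightarrow> finite {e. mps_coeff a e \<noteq> 0}"

text \<open>The zero series has order \<open>\<infinity>\<close>.\<close>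

definition mps_ord :: "('k::zero, 'n::finite) mps \<Rightarrow> enat" where
  "mps_ord a = (INF e \<in> {e. mps_coeff a e \<noteq> 0}. enat (\<Sum>i\<in>UNIV. e i))"

definition vec_ord :: "('k::zero, 'n::finite) mps ^ 'm \<Rightarrow> enat" where
  "vec_ord f = (INF i. mps_ord (f $ i))"


section \<open>Ideals, submodules of \<open>R\<^sup>m\<close> and \<open>K\<close>-subspaces\<close>

definition ideal_gen :: "'a::comm_ring_1 set \<Rightarrow> 'a set" where
  "ideal_gen S = module.span (*) S"

definition ideal_prod :: "'a::comm_ring_1 set \<Rightarrow> 'a set \<Rightarrow> 'a set" where
  "ideal_prod I J = ideal_gen {a * b | a b. a \<in> I \<and> b \<in> J}"

primrec ideal_pow :: "'a::comm_ring_1 set \<Rightarrow> nat \<Rightarrow> 'a set" where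
  "ideal_pow I 0 = UNIV"
| "ideal_pow I (Suc k) = ideal_prod I (ideal_pow I k)"

definition submod_gen :: "('a::comm_ring_1 ^ 'm) set \<Rightarrow> ('a ^ 'm) set" where
  "submod_gen S = module.span (*s) S"

definition ideal_smult :: "'a::comm_ring_1 set \<Rightarrow> ('a ^ 'm) set \<Rightarrow> ('a ^ 'm) set" where
  "ideal_smult I N = submod_gen {a *s v | a v. a \<in> I \<and> v \<in> N}"

definition kscale :: "'k::field \<Rightarrow> ('k, 'n::finite) mps \<Rightarrow> ('k, 'n) mps" where
  "kscale c a = mps_const c * a"

definition kscale_vec :: "'k::field \<Rightarrow> ('k, 'n::finite) mps ^ 'm \<Rightarrow> ('k, 'n) mps ^ 'm" where
  "kscale_vec c v = mps_const c *s v"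

lemma mps_const_add: "mps_const (a + b) = mps_const a + (mps_const b :: ('k::comm_ring_1, 'n::finite) mps)"
  by transfer auto

lemma mps_const_one: "mps_const 1 = (1 :: ('k::comm_ring_1, 'n::finite) mps)"
  by transfer auto

lemma mps_const_mult: "mps_const (a * b) = mps_const a * (mps_const b :: ('k::comm_ring_1, 'n::finite) mps)"
proof (transfer, rule ext)
  fix a b :: 'k and e :: "'n \<Rightarrow> nat"
  have "(\<Sum>c | c \<le> e. (if c = (\<lambda>_. 0) then a else 0) * (if e - c = (\<lambda>_. 0) then b else 0)) =
      (\<Sum>c | c \<le> e. if c = (\<lambda>_. 0) then a * (if e - c = (\<lambda>_. 0) then b else 0) else 0)"
    by (rule sum.cong) auto
  also have "\<dots> = (if e = (\<lambda>_. 0) then a * b else 0)"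
    by (subst sum.delta[OF finite_exponents_le]) (auto simp: le_fun_def fun_diff_def)
  finally show "(if e = (\<lambda>_. 0) then a * b else 0) =
    (\<Sum>c | c \<le> e. (if c = (\<lambda>_. 0) then a else 0) * (if e - c = (\<lambda>_. 0) then b else 0))" by simp
qed

text \<open>These justify the use of \<^const>\<open>module.span\<close> above and of \<open>K\<close>-spans below.\<close>

lemma module_mult: "module ((*) :: 'a::comm_ring_1 \<Rightarrow> 'a \<Rightarrow> 'a)"
  by unfold_locales (auto simp: algebra_simps)

lemma module_smult: "module ((*s) :: 'a::comm_ring_1 \<Rightarrow> 'a ^ 'm \<Rightarrow> 'a ^ 'm)"
  by unfold_locales (auto simp: vec_eq_iff algebra_simps)

lemma vector_space_kscale: "vector_space (kscale :: 'k::field \<Rightarrow> ('k, 'n::finite) mps \<Rightarrow> _)"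
  by unfold_locales
    (auto simp: kscale_def algebra_simps mps_const_add mps_const_mult mps_const_one)

lemma vector_space_kscale_vec:
  "vector_space (kscale_vec :: 'k::field \<Rightarrow> ('k, 'n::finite) mps ^ 'm \<Rightarrow> _)"
  by unfold_locales
    (auto simp: kscale_vec_def vec_eq_iff algebra_simps mps_const_add mps_const_mult mps_const_one)

text \<open>
  \<open>B\<close> represents a \<open>K\<close>-basis of \<open>V/W\<close>. As for the library's \<open>dim\<close>, the dimension of \<open>V/W\<close>
  is the cardinality of any basis (and \<open>0\<close> if infinite).
\<close>

definition quot_basis :: "('k::field \<Rightarrow> 'v \<Rightarrow> 'v) \<Rightarrow> 'v::ab_group_add set \<Rightarrow> 'v set \<Rightarrow> 'v set \<Rightarrow> bool" where
  "quot_basis sc V W B \<longleftrightarrow>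
     B \<subseteq> V \<and> module.span sc B + W = V \<and>
     (\<forall>T u. finite T \<and> T \<subseteq> B \<and> (\<Sum>b\<in>T. sc (u b) b) \<in> W \<longrightarrow> (\<forall>b\<in>T. u b = 0))"

definition quot_dim :: "('k::field \<Rightarrow> 'v \<Rightarrow> 'v) \<Rightarrow> 'v::ab_group_add set \<Rightarrow> 'v set \<Rightarrow> nat" where
  "quot_dim sc V W = card (SOME B. quot_basis sc V W B)"

definition max_ideal :: "('k::field, 'n::finite) mps set" where
  "max_ideal = ideal_gen (range mps_var)"

definition mng :: "('k::field, 'n::finite) mps set \<Rightarrow> nat" where
  "mng I = quot_dim kscale I (ideal_prod max_ideal I)"


section \<open>Isolated complete intersection singularities\<close>

definition comp_ideal :: "('k::field, 'n::finite) mps ^ 'm \<Rightarrow> ('k, 'n) mps set" where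
  "comp_ideal f = ideal_gen (range (($) f))"

text \<open>\<open>complete_intersection m I\<close>: the element \<open>hs ! i\<close> is a non-zero divisor modulo the preceding ones.\<close>

definition complete_intersection :: "nat \<Rightarrow> ('k::field, 'n::finite) mps set \<Rightarrow> bool" where
  "complete_intersection m I \<longleftrightarrow>
     (\<exists>hs. length hs = m \<and> set hs \<subseteq> max_ideal \<and> ideal_gen (set hs) = I \<and>
       (\<forall>i<m. \<forall>r. r * hs ! i \<in> ideal_gen (set (take i hs)) \<longrightarrow> r \<in> ideal_gen (set (take i hs))))"

definition jacobian :: "('k::field, 'n::finite) mps ^ 'm \<Rightarrow> ('k, 'n) mps ^ 'n ^ 'm" where
  "jacobian f = (\<chi> i j. mps_deriv j (f $ i))"

text \<open>
  The maximal minors are indexed by injective choices \<open>c\<close> of columns; permuting the columns only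
  changes the sign.
\<close>

definition max_minors_ideal :: "'a::comm_ring_1 ^ 'n ^ 'm \<Rightarrow> 'a set" where
  "max_minors_ideal A = ideal_gen {det (\<chi> i j. A $ i $ c j) | c :: 'm \<Rightarrow> 'n. inj c}"

text \<open>The set \<open>I\<^bsub>m,n\<^esub>\<close>, with \<open>m = CARD('m)\<close>.\<close>

definition ICIS :: "(('k::field, 'n::finite) mps ^ 'm) set" where
  "ICIS = {f. (\<forall>i. f $ i \<in> max_ideal) \<and>
     complete_intersection CARD('m) (comp_ideal f) \<and>
     (\<exists>k>0. ideal_pow max_ideal k \<subseteq> comp_ideal f + max_minors_ideal (jacobian f)) \<and>
     mng (comp_ideal f) = CARD('m)}"


section \<open>Contact equivalence and simplicity\<close>

definition mps_automorphism :: "(('k::field, 'n::finite) mps \<Rightarrow> ('k, 'n) mps) \<Rightarrow> bool" where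
  "mps_automorphism \<phi> \<longleftrightarrow> bij \<phi> \<and>
     (\<forall>a b. \<phi> (a + b) = \<phi> a + \<phi> b) \<and> (\<forall>a b. \<phi> (a * b) = \<phi> a * \<phi> b) \<and>
     (\<forall>c. \<phi> (mps_const c) = mps_const c)"

definition contact_equiv ::
  "('k::field, 'n::finite) mps ^ 'm \<Rightarrow> ('k, 'n) mps ^ 'm \<Rightarrow> bool" where
  "contact_equiv f g \<longleftrightarrow>
     (\<exists>(U :: ('k, 'n) mps ^ 'm ^ 'm) \<phi>. invertible U \<and> mps_automorphism \<phi> \<and>
       g = U *v (\<chi> i. \<phi> (f $ i)))"

definition tangent_contact :: "('k::field, 'n::finite) mps ^ 'm \<Rightarrow> (('k, 'n) mps ^ 'm) set" where
  "tangent_contact f =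
     ideal_smult (comp_ideal f) UNIV +
     ideal_smult max_ideal (submod_gen (range (\<lambda>j. \<chi> i. mps_deriv j (f $ i))))"

text \<open>
  \<open>gs\<close> consists of polynomial vectors with components in the maximal ideal whose classes generate
  \<open>T\<^bsup>1,sec\<^esup>(f) = \<mm> R\<^sup>m / T\<close> over \<open>K\<close>, where \<open>T\<close> is \<^term>\<open>tangent_contact f\<close>.
\<close>

definition T1sec_generators ::
  "('k::field, 'n::finite) mps ^ 'm \<Rightarrow> (('k, 'n) mps ^ 'm) list \<Rightarrow> bool" where
  "T1sec_generators f gs \<longleftrightarrow>
     (\<forall>g\<in>set gs. \<forall>i. mps_is_poly (g $ i) \<and> g $ i \<in> max_ideal) \<and>
     module.span kscale_vec (set gs) + tangent_contact f = ideal_smult max_ideal UNIV"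

definition unfolding_at ::
  "('k::field, 'n::finite) mps ^ 'm \<Rightarrow> (('k, 'n) mps ^ 'm) list \<Rightarrow> (nat \<Rightarrow> 'k) \<Rightarrow> ('k, 'n) mps ^ 'm" where
  "unfolding_at f gs t = f + (\<Sum>i<length gs. kscale_vec (t i) (gs ! i))"

text \<open>Points of \<open>K\<^sup>d\<close> are functions on \<^typ>\<open>nat\<close> that vanish from index \<open>d\<close> on.\<close>

definition affine_space :: "nat \<Rightarrow> (nat \<Rightarrow> 'k::zero) set" where
  "affine_space d = {t. \<forall>i\<ge>d. t i = 0}"

definition eval_mpoly :: "((nat \<Rightarrow>\<^sub>0 nat) \<Rightarrow>\<^sub>0 'k::field) \<Rightarrow> (nat \<Rightarrow> 'k) \<Rightarrow> 'k" where
  "eval_mpoly p t =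
     (\<Sum>e\<in>Poly_Mapping.keys p. Poly_Mapping.lookup p e *
       (\<Prod>i\<in>Poly_Mapping.keys e. t i ^ Poly_Mapping.lookup e i))"

definition zariski_open :: "nat \<Rightarrow> (nat \<Rightarrow> 'k::field) set \<Rightarrow> bool" where
  "zariski_open d U \<longleftrightarrow>
     (\<exists>P. (\<forall>p\<in>P. \<forall>e\<in>Poly_Mapping.keys p. Poly_Mapping.keys e \<subseteq> {..<d}) \<and>
       U = affine_space d - {t. \<forall>p\<in>P. eval_mpoly p t = 0})"

text \<open>
  The generators are quantified existentially, so that \<open>\<not> simple f\<close> says that the finiteness
  condition fails for every choice of generators.
\<close>

definition simple :: "('k::field, 'n::finite) mps ^ 'm \<Rightarrow> bool" where
  "simple f \<longleftrightarrow>
     (\<exists>gs H U. T1sec_generators f gs \<and> finite H \<and> H \<subseteq> ICIS \<and>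
       zariski_open (length gs) U \<and> (\<lambda>_. 0) \<in> U \<and>
       (\<forall>t\<in>U. \<exists>h\<in>H. contact_equiv (unfolding_at f gs t) h))"

end

theory Submission
  imports Defs
begin

text \<open>
  Let \<open>d = 3\<close> if \<open>n = 2\<close> and \<open>d = 2\<close> if \<open>n \<ge> 3\<close>, so that \<open>f\<close> has order at least \<open>d\<close>. Contact
  equivalent vectors of order at least \<open>d\<close> have leading forms of degree \<open>d\<close> in one orbit of
  \<open>GL\<^sub>n \<times> GL\<^sub>n\<close>, and since one parameter only rescales, such an orbit depends on \<open>2n\<^sup>2 - 1\<close>
  parameters, whereas \<open>n\<close>-tuples of forms of degree \<open>d\<close> form a space of dimension at least \<open>2n\<^sup>2\<close>.
  So finitely many orbits satisfy a common nontrivial polynomial relation. On the other hand, the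
  members of order at least \<open>d\<close> of the unfolding are transversal at \<open>f\<close> to the orbit: moving them
  with the group gives curves through the leading form of \<open>f\<close> in every direction, on which
  the relation holds up to finitely many points. Hence the lowest-order part of the relation
  at the leading form of \<open>f\<close> vanishes identically, a contradiction as \<open>K\<close> is infinite. Forms are
  represented by their values on a finite set of interpolation points.
\<close>

section \<open>Polynomial relations over an infinite field\<close>

text \<open>Gaussian elimination: if the equation \<open>y\<close> involves the unknown
  \<open>x0\<close>, then \<open>x0\<close> is eliminated from the other equations, which leaves one
  equation and one unknown fewer. Afterwards \<open>c0\<close> is the value of \<open>x0\<close>
  that solves equation \<open>y\<close>.\<close>

lemma homogeneous_system_nontrivial_solution:
  fixes a :: "'x \<Rightarrow> 'y \<Rightarrow> 'k::field"
  assumes "finite Y" "finite X" "card Y < card X"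
  shows "\<exists>c. (\<exists>x\<in>X. c x \<noteq> 0) \<and> (\<forall>y\<in>Y. (\<Sum>x\<in>X. c x * a x y) = 0)"
  using assms
proof (induction Y arbitrary: X a rule: finite_induct)
  case empty
  then obtain x where "x \<in> X" by fastforce
  then show ?case by (intro exI[of _ "\<lambda>_. 1"]) auto
next
  case (insert y Y)
  show ?case
  proof (cases "\<exists>x\<in>X. a x y \<noteq> 0")
    case False
    obtain c where "\<exists>x\<in>X. c x \<noteq> 0" "\<forall>y\<in>Y. (\<Sum>x\<in>X. c x * a x y) = 0"
      using insert.IH[of X a] insert.prems insert.hyps by auto
    then show ?thesis using False by (intro exI[of _ c]) auto
  next
    case True
    then obtain x0 where x0: "x0 \<in> X" "a x0 y \<noteq> 0" by blast
    define X' where "X' = X - {x0}"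
    have fX': "finite X'" "x0 \<notin> X'" "X = insert x0 X'" using insert.prems x0 by (auto simp: X'_def)
    have "card Y < card X'" using insert.prems insert.hyps fX' by simp
    then obtain c where c: "\<exists>x\<in>X'. c x \<noteq> 0"
      "\<forall>z\<in>Y. (\<Sum>x\<in>X'. c x * (a x z - a x y / a x0 y * a x0 z)) = 0"
      using insert.IH[OF fX'(1), of "\<lambda>x z. a x z - a x y / a x0 y * a x0 z"] by blast
    define c0 where "c0 = - (\<Sum>x\<in>X'. c x * a x y) / a x0 y"
    have *: "(\<Sum>x\<in>X. (c(x0 := c0)) x * a x z) = c0 * a x0 z + (\<Sum>x\<in>X'. c x * a x z)" for z
    proof -
      have "(\<Sum>x\<in>X'. (c(x0 := c0)) x * a x z) = (\<Sum>x\<in>X'. c x * a x z)"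
        using fX' by (intro sum.cong) auto
      then show ?thesis using fX' by simp
    qed
    have "(\<Sum>x\<in>X. (c(x0 := c0)) x * a x z) = 0" if "z \<in> insert y Y" for z
    proof (cases "z = y")
      case True
      then show ?thesis unfolding * using x0 by (simp add: c0_def)
    next
      case False
      then have "z \<in> Y" using that by simp
      then have "0 = (\<Sum>x\<in>X'. c x * (a x z - a x y / a x0 y * a x0 z))" using c(2) by simp
      also have "\<dots> = (\<Sum>x\<in>X'. c x * a x z) + c0 * a x0 z"
        by (simp add: c0_def algebra_simps sum_subtractf sum_distrib_left sum_divide_distrib)
      finally show ?thesis unfolding * by (simp add: add.commute)
    qed
    moreover have "\<exists>x\<in>X. (c(x0 := c0)) x \<noteq> 0" using c(1) fX' by auto
    ultimately show ?thesis by blast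
  qed
qed

text \<open>Induction on the variables. With the other variables fixed, the sum is a polynomial in
  \<open>y\<close> that vanishes on an infinite field, so each of its coefficients vanishes; these
  are again sums of monomials in the remaining variables. The injectivity condition says that
  distinct members of \<open>S\<close> give distinct monomials in the variables from
  \<open>X\<close>.\<close>

lemma monomials_independent:
  fixes c :: "('j \<Rightarrow> nat) \<Rightarrow> 'k::field"
  assumes inf: "infinite (UNIV :: 'k set)"
    and "finite X" "finite S" "inj_on (\<lambda>\<alpha>. restrict \<alpha> X) S"
    and "\<And>x. (\<Sum>\<alpha>\<in>S. c \<alpha> * (\<Prod>j\<in>X. x j ^ \<alpha> j)) = 0"
  shows "\<forall>\<alpha>\<in>S. c \<alpha> = 0"
  using assms(2-)
proof (induction X arbitrary: S rule: finite_induct)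
  case empty
  show ?case
  proof
    fix \<alpha> assume "\<alpha> \<in> S"
    then have "S = {\<alpha>}" using empty.prems(2) by (auto simp: inj_on_def)
    then show "c \<alpha> = 0" using empty.prems(3) by simp
  qed
next
  case (insert y X)
  define T where "T k = {\<alpha>\<in>S. \<alpha> y = k}" for k
  show ?case
  proof
    fix \<beta> assume \<beta>: "\<beta> \<in> S"
    have "(\<Sum>\<alpha>\<in>T (\<beta> y). c \<alpha> * (\<Prod>j\<in>X. x j ^ \<alpha> j)) = 0" for x
    proof -
      define P where "P = (\<Sum>\<alpha>\<in>S. monom (c \<alpha> * (\<Prod>j\<in>X. x j ^ \<alpha> j)) (\<alpha> y))"
      have "poly P \<tau> = 0" for \<tau>
      proof -
        have *: "(\<Prod>j\<in>insert y X. (x(y := \<tau>)) j ^ \<alpha> j) = \<tau> ^ \<alpha> y * (\<Prod>j\<in>X. x j ^ \<alpha> j)" for \<alpha> :: "'j \<Rightarrow> nat"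
        proof -
          have "(\<Prod>j\<in>X. (x(y := \<tau>)) j ^ \<alpha> j) = (\<Prod>j\<in>X. x j ^ \<alpha> j)"
            using insert.hyps by (intro prod.cong) auto
          then show ?thesis using insert.hyps by simp
        qed
        show ?thesis using insert.prems(3)[of "x(y := \<tau>)"]
          unfolding * by (simp add: P_def poly_sum poly_monom algebra_simps)
      qed
      then have "P = 0" using inf poly_roots_finite[of P] by auto
      then have "coeff P (\<beta> y) = 0" by simp
      then have "(\<Sum>\<alpha>\<in>S. if \<alpha> y = \<beta> y then c \<alpha> * (\<Prod>j\<in>X. x j ^ \<alpha> j) else 0) = 0"
        by (simp add: P_def coeff_sum)
      then show ?thesis using insert.prems(1) by (simp add: T_def sum.inter_filter)
    qed
    moreover have "inj_on (\<lambda>\<alpha>. restrict \<alpha> X) (T (\<beta> y))"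
    proof (rule inj_onI)
      fix \<alpha> \<alpha>' assume "\<alpha> \<in> T (\<beta> y)" "\<alpha>' \<in> T (\<beta> y)" "restrict \<alpha> X = restrict \<alpha>' X"
      then have "\<alpha> \<in> S" "\<alpha>' \<in> S" "restrict \<alpha> (insert y X) = restrict \<alpha>' (insert y X)"
        by (auto simp: T_def restrict_def fun_eq_iff split: if_splits) 
      then show "\<alpha> = \<alpha>'" using insert.prems(2) by (blast dest: inj_onD)
    qed
    moreover have "finite (T (\<beta> y))" using insert.prems(1) by (simp add: T_def)
    ultimately have "\<forall>\<alpha>\<in>T (\<beta> y). c \<alpha> = 0" using insert.IH by blast
    then show "c \<beta> = 0" using \<beta> by (simp add: T_def)
  qed
qed

text \<open>The second assumption is linear independence of the functions \<open>m e\<close>. Points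
  are added one at a time, one for each function.\<close>

lemma interpolation_points:
  fixes m :: "'i \<Rightarrow> 'a \<Rightarrow> 'k::field"
  assumes "finite E"
    and "\<And>c. (\<And>x. (\<Sum>e\<in>E. c e * m e x) = 0) \<Longrightarrow> \<forall>e\<in>E. c e = 0"
  shows "\<exists>P. finite P \<and> card P = card E \<and> (\<forall>v. \<exists>c. \<forall>p\<in>P. (\<Sum>e\<in>E. c e * m e p) = v p)"
  using assms
proof (induction E rule: finite_induct)
  case empty
  then show ?case by (intro exI[of _ "{}"]) auto
next
  case (insert y E)
  have upd: "(\<Sum>e\<in>E. (c(y := t)) e * m e x) = (\<Sum>e\<in>E. c e * m e x)" for c t x
    using insert.hyps by (intro sum.cong) auto
  have "\<forall>e\<in>E. c e = 0" if "\<And>x. (\<Sum>e\<in>E. c e * m e x) = 0" for c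
    using insert.prems[of "c(y := 0)"] that insert.hyps upd by (auto split: if_splits)
  then obtain P where P: "finite P" "card P = card E"
    "\<And>v. \<exists>c. \<forall>p\<in>P. (\<Sum>e\<in>E. c e * m e p) = v p"
    using insert.IH by blast
  obtain b where b: "\<forall>p\<in>P. (\<Sum>e\<in>E. b e * m e p) = - m y p" using P(3)[of "\<lambda>p. - m y p"] by blast
  \<comment> \<open>\<open>g\<close> is the new function corrected by the old ones so as to vanish
    on \<open>P\<close>. By independence it is nonzero at some \<open>x0\<close>, and adding a
    multiple of \<open>g\<close> adjusts the value there without disturbing the values on
    \<open>P\<close>.\<close>
  define g where "g x = m y x + (\<Sum>e\<in>E. b e * m e x)" for x
  have "\<exists>x. g x \<noteq> 0"
  proof (rule ccontr)
    assume "\<nexists>x. g x \<noteq> 0"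
    then have "\<forall>e\<in>insert y E. (b(y := 1)) e = 0"
      using insert.prems[of "b(y := 1)"] insert.hyps upd by (auto simp: g_def)
    then show False by simp
  qed
  then obtain x0 where x0: "g x0 \<noteq> 0" by blast
  have gP: "g p = 0" if "p \<in> P" for p using b that by (simp add: g_def)
  have "\<exists>c. \<forall>p\<in>insert x0 P. (\<Sum>e\<in>insert y E. c e * m e p) = v p" for v
  proof -
    obtain c where c: "\<forall>p\<in>P. (\<Sum>e\<in>E. c e * m e p) = v p" using P(3) by blast
    define t where "t = (v x0 - (\<Sum>e\<in>E. c e * m e x0)) / g x0"
    have *: "(\<Sum>e\<in>insert y E. ((\<lambda>e. c e + t * b e)(y := t)) e * m e p) = (\<Sum>e\<in>E. c e * m e p) + t * g p" for p
      unfolding sum.insert[OF insert.hyps] upd g_def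
      by (simp add: algebra_simps sum.distrib sum_distrib_left)
    show ?thesis
      by (intro exI[of _ "(\<lambda>e. c e + t * b e)(y := t)"], unfold *) (use c gP x0 in \<open>auto simp: t_def\<close>)
  qed
  moreover have "x0 \<notin> P" using gP x0 by blast
  ultimately show ?case using P insert.hyps by (intro exI[of _ "insert x0 P"]) auto
qed

text \<open>Over a finite field, one plus the product of all linear factors is a nonconstant
  polynomial that takes the value 1 everywhere.\<close>

lemma alg_closed_field_infinite: "infinite (UNIV :: 'k::alg_closed_field set)"
proof
  assume fin: "finite (UNIV :: 'k set)"
  define P where "P = (\<Prod>a\<in>(UNIV :: 'k set). [:- a, 1:]) + 1"
  have "degree (\<Prod>a\<in>(UNIV :: 'k set). [:- a, 1:]) = card (UNIV :: 'k set)"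
    by (subst degree_prod_eq_sum_degree) auto
  moreover have "card (UNIV :: 'k set) > 0" using fin by (simp add: card_gt_0_iff)
  ultimately have "degree P > 0" unfolding P_def by (subst degree_add_eq_left) auto
  then obtain x where "poly P x = 0" using alg_closed_imp_poly_has_root by blast
  moreover have "poly (\<Prod>a\<in>(UNIV :: 'k set). [:- a, 1:]) x = 0"
    using fin by (auto simp: poly_prod prod_zero_iff)
  ultimately show False by (simp add: P_def)
qed

section \<open>Polynomial functions with bounded exponents, and algebraic dependence\<close>

text \<open>The exponents are bounded in each variable separately rather than in total, so that the
  admissible monomials form a box whose size is a product.\<close>

definition polyfun :: "('p \<Rightarrow> nat) \<Rightarrow> (('p::finite \<Rightarrow> 'k::field) \<Rightarrow> 'k) \<Rightarrow> bool" where
  "polyfun u g \<longleftrightarrow> (\<exists>b. \<forall>z. g z = (\<Sum>\<beta> | \<beta> \<le> u. b \<beta> * (\<Prod>x\<in>UNIV. z x ^ \<beta> x)))"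

lemma polyfun_mono:
  assumes "polyfun u g" "u \<le> v"
  shows "polyfun v g"
proof -
  obtain b where b: "\<And>z. g z = (\<Sum>\<beta> | \<beta> \<le> u. b \<beta> * (\<Prod>x\<in>UNIV. z x ^ \<beta> x))"
    using assms(1) unfolding polyfun_def by blast
  have "g z = (\<Sum>\<beta> | \<beta> \<le> v. (if \<beta> \<le> u then b \<beta> else 0) * (\<Prod>x\<in>UNIV. z x ^ \<beta> x))" for z
    unfolding b using assms(2)
    by (intro sum.mono_neutral_cong_left finite_exponents_le) auto
  then show ?thesis unfolding polyfun_def by (intro exI allI)
qed

lemma polyfun_const: "polyfun u (\<lambda>_. c)"
proof -
  have "polyfun (\<lambda>_. 0) (\<lambda>_::'a \<Rightarrow> 'b. c)"
    unfolding polyfun_def by (intro exI[of _ "\<lambda>_. c"]) (simp add: le_fun_def flip: fun_eq_iff)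
  then show ?thesis by (rule polyfun_mono) (simp add: le_fun_def)
qed

lemma polyfun_var:
  assumes "u x \<ge> 1"
  shows "polyfun u (\<lambda>z. z x)"
proof -
  have "z x = (\<Sum>\<beta> | \<beta> \<le> u. (if \<beta> = (\<lambda>_. 0)(x := 1) then 1 else 0) * (\<Prod>y\<in>UNIV. z y ^ \<beta> y))" for z :: "'a \<Rightarrow> 'b"
  proof -
    have "(\<Sum>\<beta> | \<beta> \<le> u. (if \<beta> = (\<lambda>_. 0)(x := 1) then 1 else 0) * (\<Prod>y\<in>UNIV. z y ^ \<beta> y))
      = (\<Sum>\<beta> | \<beta> \<le> u. if \<beta> = (\<lambda>_. 0)(x := 1) then (\<Prod>y\<in>UNIV. z y ^ \<beta> y) else 0)"
      by (intro sum.cong) auto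
    also have "\<dots> = (\<Prod>y\<in>UNIV. z y ^ ((\<lambda>_. 0)(x := 1)) y)"
      using assms by (subst sum.delta[OF finite_exponents_le]) (auto simp: le_fun_def)
    also have "\<dots> = (\<Prod>y\<in>UNIV. if y = x then z y else 1)"
      by (intro prod.cong) auto
    finally show ?thesis by simp
  qed
  then show ?thesis unfolding polyfun_def by (intro exI allI)
qed

lemma polyfun_add:
  assumes "polyfun u g" "polyfun u h"
  shows "polyfun u (\<lambda>z. g z + h z)"
proof -
  obtain b c where "\<And>z. g z = (\<Sum>\<beta> | \<beta> \<le> u. b \<beta> * (\<Prod>x\<in>UNIV. z x ^ \<beta> x))"
    "\<And>z. h z = (\<Sum>\<beta> | \<beta> \<le> u. c \<beta> * (\<Prod>x\<in>UNIV. z x ^ \<beta> x))"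
    using assms unfolding polyfun_def by blast
  then show ?thesis unfolding polyfun_def
    by (intro exI[of _ "\<lambda>\<beta>. b \<beta> + c \<beta>"]) (simp add: sum.distrib algebra_simps)
qed

lemma polyfun_mult:
  assumes "polyfun u g" "polyfun v h"
  shows "polyfun (\<lambda>x. u x + v x) (\<lambda>z. g z * h z)"
proof -
  obtain b c where b: "\<And>z. g z = (\<Sum>\<beta> | \<beta> \<le> u. b \<beta> * (\<Prod>x\<in>UNIV. z x ^ \<beta> x))"
    and c: "\<And>z. h z = (\<Sum>\<beta> | \<beta> \<le> v. c \<beta> * (\<Prod>x\<in>UNIV. z x ^ \<beta> x))"
    using assms unfolding polyfun_def by blast
  define B where "B = {\<beta>. \<beta> \<le> u} \<times> {\<gamma>. \<gamma> \<le> v}"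
  have finB: "finite B" by (simp add: B_def finite_exponents_le)
  define s :: "('a \<Rightarrow> nat) \<times> ('a \<Rightarrow> nat) \<Rightarrow> 'a \<Rightarrow> nat" where "s = (\<lambda>(\<beta>, \<gamma>). (\<lambda>x. \<beta> x + \<gamma> x :: nat))"
  have "g z * h z = (\<Sum>\<delta> | \<delta> \<le> (\<lambda>x. u x + v x).
      (\<Sum>p\<in>{p\<in>B. s p = \<delta>}. b (fst p) * c (snd p)) * (\<Prod>x\<in>UNIV. z x ^ \<delta> x))" for z
  proof -
    have "g z * h z = (\<Sum>p\<in>B. b (fst p) * c (snd p) * (\<Prod>x\<in>UNIV. z x ^ s p x))"
      unfolding b c B_def s_def sum_product sum.cartesian_product
      by (intro sum.cong) (auto simp: power_add prod.distrib algebra_simps)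
    also have "\<dots> = (\<Sum>\<delta> | \<delta> \<le> (\<lambda>x. u x + v x).
        \<Sum>p\<in>{p\<in>B. s p = \<delta>}. b (fst p) * c (snd p) * (\<Prod>x\<in>UNIV. z x ^ s p x))"
      by (intro sum.group[symmetric] finB finite_exponents_le)
        (auto simp: B_def s_def le_fun_def intro: add_mono)
    also have "\<dots> = (\<Sum>\<delta> | \<delta> \<le> (\<lambda>x. u x + v x).
      (\<Sum>p\<in>{p\<in>B. s p = \<delta>}. b (fst p) * c (snd p)) * (\<Prod>x\<in>UNIV. z x ^ \<delta> x))"
      unfolding sum_distrib_right by (intro sum.cong) auto
    finally show ?thesis .
  qed
  then show ?thesis unfolding polyfun_def by (intro exI allI)
qed

text \<open>The bound 0 outside \<open>X\<close> excludes those variables, so the number of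
  admissible monomials has exponent \<open>card X\<close> instead of the number of all
  variables.\<close>

definition poly_in :: "'p set \<Rightarrow> nat \<Rightarrow> (('p::finite \<Rightarrow> 'k::field) \<Rightarrow> 'k) \<Rightarrow> bool" where
  "poly_in X C = polyfun (\<lambda>x. if x \<in> X then C else 0)"

lemma poly_in_mono: "poly_in X C g \<Longrightarrow> C \<le> D \<Longrightarrow> poly_in X D g"
  unfolding poly_in_def by (erule polyfun_mono) (auto simp: le_fun_def)

lemma poly_in_const: "poly_in X C (\<lambda>_. c)"
  unfolding poly_in_def by (rule polyfun_const)

lemma poly_in_var: "x \<in> X \<Longrightarrow> 1 \<le> C \<Longrightarrow> poly_in X C (\<lambda>z. z x)"
  unfolding poly_in_def by (rule polyfun_var) auto

lemma poly_in_add: "poly_in X C g \<Longrightarrow> poly_in X C h \<Longrightarrow> poly_in X C (\<lambda>z. g z + h z)"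
  unfolding poly_in_def by (rule polyfun_add)

lemma poly_in_sum:
  "(\<And>i. i \<in> I \<Longrightarrow> poly_in X C (g i)) \<Longrightarrow> poly_in X C (\<lambda>z. \<Sum>i\<in>I. g i z)"
  by (induction I rule: infinite_finite_induct) (auto intro: poly_in_add poly_in_const)

lemma poly_in_mult:
  assumes "poly_in X C g" "poly_in X D h"
  shows "poly_in X (C + D) (\<lambda>z. g z * h z)"
proof -
  have "(\<lambda>x. (if x \<in> X then C else 0) + (if x \<in> X then D else 0)) = (\<lambda>x. if x \<in> X then C + D else 0)"
    by auto
  then show ?thesis using polyfun_mult[OF assms[unfolded poly_in_def]] by (simp add: poly_in_def)
qed

lemma poly_in_power:
  assumes "poly_in X C g"
  shows "poly_in X (n * C) (\<lambda>z. g z ^ n)"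
  by (induction n) (auto intro: poly_in_const poly_in_mult assms)

lemma poly_in_prod:
  "(\<And>i. i \<in> I \<Longrightarrow> poly_in X (C i) (g i)) \<Longrightarrow> poly_in X (\<Sum>i\<in>I. C i) (\<lambda>z. \<Prod>i\<in>I. g i z)"
  by (induction I rule: infinite_finite_induct) (auto intro: poly_in_mult poly_in_const)

lemma card_bounded_exponents:
  "card {\<beta>. \<beta> \<le> (\<lambda>x::'p::finite. if x \<in> X then C else 0)} = (C + 1) ^ card X"
proof -
  have "{\<beta>. \<beta> \<le> (\<lambda>x::'p. if x \<in> X then C else 0)} = PiE UNIV (\<lambda>x. {..if x \<in> X then C else 0})"
    unfolding le_fun_def PiE_UNIV_domain by blast
  then have "card {\<beta>. \<beta> \<le> (\<lambda>x::'p. if x \<in> X then C else 0)} = (\<Prod>x\<in>UNIV. if x \<in> X then C + 1 else 1)"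
    by (simp add: card_PiE) (intro prod.cong, auto)
  also have "\<dots> = (\<Prod>x\<in>X. C + 1)" 
    by (subst prod.inter_filter[symmetric]) auto
  finally show ?thesis by simp
qed

text \<open>
  Counting monomials: there are \<open>(D + 1)\<^sup>N\<close> of them in the \<open>N = card J\<close> target coordinates, but
  pulled back they satisfy only \<open>O(D\<^sup>M)\<close> linear conditions, where \<open>M < N\<close>.
\<close>

lemma algebraic_dependence:
  fixes \<Phi> :: "'q \<Rightarrow> 'j \<Rightarrow> ('p::finite \<Rightarrow> 'k::field) \<Rightarrow> 'k"
  assumes J: "finite J" and Q: "finite Q"
    and X: "\<And>q. q \<in> Q \<Longrightarrow> card (X q) < card J"
    and \<Phi>: "\<And>q j. q \<in> Q \<Longrightarrow> j \<in> J \<Longrightarrow> poly_in (X q) C (\<Phi> q j)"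
  obtains D c where "\<exists>\<alpha>\<in>PiE J (\<lambda>_. {..D}). c \<alpha> \<noteq> 0"
    and "\<And>q z. q \<in> Q \<Longrightarrow> (\<Sum>\<alpha>\<in>PiE J (\<lambda>_. {..D}). c \<alpha> * (\<Prod>j\<in>J. \<Phi> q j z ^ \<alpha> j)) = 0"
proof -
  \<comment> \<open>\<open>E\<close> bounds the exponents in the pulled back monomials, and
    \<open>L\<close> is chosen so that \<open>E + 1\<close> is at most \<open>(D + 1) * L\<close>.
    The number of conditions is then at most \<open>card Q * L ^ M * (D + 1) ^ M\<close>, and the
    choice of \<open>D\<close> makes this \<open>D * (D + 1) ^ M\<close>, just below the number of
    unknowns.\<close>
  define M where "M = card J - 1"
  define L where "L = card J * C + 1"
  define D where "D = card Q * L ^ M"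
  define E where "E = D * (card J * C)"
  define S where "S = PiE J (\<lambda>_. {..D})"
  define Box where "Box q = {\<beta>. \<beta> \<le> (\<lambda>x. if x \<in> X q then E else 0)}" for q
  have finS: "finite S" unfolding S_def using J by (intro finite_PiE) auto
  have cardS: "card S = (D + 1) ^ card J" unfolding S_def using J by (simp add: card_PiE)
  have poly: "poly_in (X q) E (\<lambda>z. \<Prod>j\<in>J. \<Phi> q j z ^ \<alpha> j)" if "q \<in> Q" "\<alpha> \<in> S" for q \<alpha>
  proof -
    have "poly_in (X q) (\<Sum>j\<in>J. \<alpha> j * C) (\<lambda>z. \<Prod>j\<in>J. \<Phi> q j z ^ \<alpha> j)"
      by (intro poly_in_prod poly_in_power \<Phi> that)
    moreover have "(\<Sum>j\<in>J. \<alpha> j * C) \<le> (\<Sum>j\<in>J. D * C)"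
      using that(2) by (intro sum_mono mult_right_mono) (auto simp: S_def)
    ultimately show ?thesis by (auto simp: E_def mult_ac elim: poly_in_mono)
  qed
  have "\<exists>b. \<forall>z. (\<Prod>j\<in>J. \<Phi> q j z ^ \<alpha> j) = (\<Sum>\<beta>\<in>Box q. b \<beta> * (\<Prod>x\<in>UNIV. z x ^ \<beta> x))"
    if "q \<in> Q" "\<alpha> \<in> S" for q \<alpha>
    using poly[OF that] unfolding poly_in_def polyfun_def Box_def .
  then have "\<forall>p\<in>Q \<times> S. \<exists>b. \<forall>z. (\<Prod>j\<in>J. \<Phi> (fst p) j z ^ snd p j) = (\<Sum>\<beta>\<in>Box (fst p). b \<beta> * (\<Prod>x\<in>UNIV. z x ^ \<beta> x))"
    by auto
  from bchoice[OF this] obtain b where "\<forall>p\<in>Q \<times> S. \<forall>z. (\<Prod>j\<in>J. \<Phi> (fst p) j z ^ snd p j)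
      = (\<Sum>\<beta>\<in>Box (fst p). b p \<beta> * (\<Prod>x\<in>UNIV. z x ^ \<beta> x))" ..
  then have b: "(\<Prod>j\<in>J. \<Phi> q j z ^ \<alpha> j) = (\<Sum>\<beta>\<in>Box q. b (q, \<alpha>) \<beta> * (\<Prod>x\<in>UNIV. z x ^ \<beta> x))"
    if "q \<in> Q" "\<alpha> \<in> S" for q \<alpha> z
    using that by auto
  \<comment> \<open>One linear condition for each \<open>q\<close> and each monomial in the source
    variables: the coefficient of that monomial in the pulled back relation has to vanish.\<close>
  define Y where "Y = Sigma Q Box"
  have finY: "finite Y" unfolding Y_def using Q by (auto simp: Box_def finite_exponents_le)
  have "card Y < card S"
  proof (cases "Q = {}")
    case True
    then show ?thesis using cardS by (simp add: Y_def)
  next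
    case False
    then have Jpos: "card J = Suc M" using X by (fastforce simp: M_def)
    have "card Y = (\<Sum>q\<in>Q. (E + 1) ^ card (X q))"
      unfolding Y_def Box_def using Q by (simp add: card_SigmaI finite_exponents_le card_bounded_exponents del: add_Suc_right)
    also have "\<dots> \<le> (\<Sum>q\<in>Q. ((D + 1) * L) ^ M)"
    proof (rule sum_mono)
      fix q assume "q \<in> Q"
      then have "card (X q) \<le> M" using X Jpos by (metis less_Suc_eq_le)
      then have "(E + 1) ^ card (X q) \<le> (E + 1) ^ M" by (intro power_increasing) auto
      also have "\<dots> \<le> ((D + 1) * L) ^ M" by (intro power_mono) (auto simp: E_def L_def algebra_simps)
      finally show "(E + 1) ^ card (X q) \<le> ((D + 1) * L) ^ M" .
    qed
    also have "\<dots> = D * (D + 1) ^ M" unfolding power_mult_distrib by (simp add: D_def)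
    also have "\<dots> < (D + 1) ^ card J" by (simp add: Jpos)
    finally show ?thesis by (simp add: cardS)
  qed
  then obtain c where c: "\<exists>\<alpha>\<in>S. c \<alpha> \<noteq> 0" "\<And>y. y \<in> Y \<Longrightarrow> (\<Sum>\<alpha>\<in>S. c \<alpha> * b (fst y, \<alpha>) (snd y)) = 0"
    using homogeneous_system_nontrivial_solution[OF finY finS, of "\<lambda>\<alpha> y. b (fst y, \<alpha>) (snd y)"] by blast
  have "(\<Sum>\<alpha>\<in>S. c \<alpha> * (\<Prod>j\<in>J. \<Phi> q j z ^ \<alpha> j)) = 0" if "q \<in> Q" for q z
  proof -
    have "(\<Sum>\<alpha>\<in>S. c \<alpha> * (\<Prod>j\<in>J. \<Phi> q j z ^ \<alpha> j))
      = (\<Sum>\<alpha>\<in>S. \<Sum>\<beta>\<in>Box q. c \<alpha> * b (q, \<alpha>) \<beta> * (\<Prod>x\<in>UNIV. z x ^ \<beta> x))"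
      using b that by (simp add: sum_distrib_left mult.assoc)
    also have "\<dots> = (\<Sum>\<beta>\<in>Box q. (\<Sum>\<alpha>\<in>S. c \<alpha> * b (q, \<alpha>) \<beta>) * (\<Prod>x\<in>UNIV. z x ^ \<beta> x))"
      by (subst sum.swap) (simp add: sum_distrib_right)
    also have "\<dots> = 0" using c(2)[of "(q, _)"] that by (simp add: Y_def)
    finally show ?thesis .
  qed
  with c(1) show ?thesis unfolding S_def by (rule that)
qed

text \<open>The form of lowest degree of such a relation would vanish at every tangent vector.\<close>

lemma no_relation_along_all_directions:
  fixes c :: "('j \<Rightarrow> nat) \<Rightarrow> 'k::field"
  assumes inf: "infinite (UNIV :: 'k set)" and J: "finite J"
    and nz: "\<exists>\<alpha>\<in>PiE J (\<lambda>_. {..D}). c \<alpha> \<noteq> 0"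
    and curve: "\<And>v. \<exists>q. (\<forall>j\<in>J. coeff (q j) 0 = 0 \<and> coeff (q j) 1 = v j) \<and>
      infinite {s. (\<Sum>\<alpha>\<in>PiE J (\<lambda>_. {..D}). c \<alpha> * (\<Prod>j\<in>J. poly (q j) s ^ \<alpha> j)) = 0}"
  shows False
proof -
  define S where "S = PiE J (\<lambda>_. {..D})"
  have finS: "finite S" unfolding S_def using J by (intro finite_PiE) auto
  \<comment> \<open>\<open>k\<close> is the lowest degree of a monomial that occurs in the
    relation.\<close>
  define k where "k = (LEAST n. \<exists>\<alpha>\<in>S. c \<alpha> \<noteq> 0 \<and> sum \<alpha> J = n)"
  have ex: "\<exists>n. \<exists>\<alpha>\<in>S. c \<alpha> \<noteq> 0 \<and> sum \<alpha> J = n" using nz unfolding S_def by blast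
  obtain \<alpha>0 where \<alpha>0: "\<alpha>0 \<in> S" "c \<alpha>0 \<noteq> 0" "sum \<alpha>0 J = k" using LeastI_ex[OF ex] unfolding k_def by blast
  have k_le: "k \<le> sum \<alpha> J" if "\<alpha> \<in> S" "c \<alpha> \<noteq> 0" for \<alpha>
    unfolding k_def using that by (intro Least_le) blast
  define T where "T = {\<alpha>\<in>S. sum \<alpha> J = k}"
  have "(\<Sum>\<alpha>\<in>T. c \<alpha> * (\<Prod>j\<in>J. v j ^ \<alpha> j)) = 0" for v
  proof -
    obtain q where q: "\<And>j. j \<in> J \<Longrightarrow> coeff (q j) 0 = 0 \<and> coeff (q j) 1 = v j"
      "infinite {s. (\<Sum>\<alpha>\<in>S. c \<alpha> * (\<Prod>j\<in>J. poly (q j) s ^ \<alpha> j)) = 0}"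
      using curve[of v] unfolding S_def by blast
    define r where "r j = poly_shift 1 (q j)" for j
    have qr: "q j = monom 1 1 * r j" "coeff (r j) 0 = v j" if "j \<in> J" for j
    proof -
      show "q j = monom 1 1 * r j"
        using q(1)[OF that] by (intro poly_eqI) (auto simp: r_def coeff_monom_mult coeff_poly_shift)
      show "coeff (r j) 0 = v j" using q(1)[OF that] by (simp add: r_def coeff_poly_shift)
    qed
    define G where "G = (\<Sum>\<alpha>\<in>S. smult (c \<alpha>) (\<Prod>j\<in>J. q j ^ \<alpha> j))"
    have "poly G s = (\<Sum>\<alpha>\<in>S. c \<alpha> * (\<Prod>j\<in>J. poly (q j) s ^ \<alpha> j))" for s
      by (simp add: G_def poly_sum poly_prod)
    then have "G = 0" using q(2) poly_roots_finite[of G] by auto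
    \<comment> \<open>Each \<open>q j\<close> is the indeterminate times \<open>r j\<close>, so a
      monomial of degree above \<open>k\<close> contributes nothing to the coefficient at
      \<open>k\<close>, and one of degree \<open>k\<close> contributes its value at
      \<open>v\<close>. Lower degrees have coefficient 0 in the relation by minimality.\<close>
    have *: "coeff (smult (c \<alpha>) (\<Prod>j\<in>J. q j ^ \<alpha> j)) k = (if sum \<alpha> J = k then c \<alpha> * (\<Prod>j\<in>J. v j ^ \<alpha> j) else 0)"
      if "\<alpha> \<in> S" for \<alpha>
    proof -
      have "(\<Prod>j\<in>J. q j ^ \<alpha> j) = (\<Prod>j\<in>J. monom 1 1 ^ \<alpha> j * r j ^ \<alpha> j)"
        by (intro prod.cong) (auto simp: qr(1) power_mult_distrib)
      also have "\<dots> = monom 1 (sum \<alpha> J) * (\<Prod>j\<in>J. r j ^ \<alpha> j)"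
        unfolding prod.distrib power_sum[symmetric] by (simp add: monom_power)
      finally have eq: "coeff (\<Prod>j\<in>J. q j ^ \<alpha> j) k =
          (if sum \<alpha> J \<le> k then coeff (\<Prod>j\<in>J. r j ^ \<alpha> j) (k - sum \<alpha> J) else 0)"
        by (simp add: coeff_monom_mult)
      have "coeff (\<Prod>j\<in>J. r j ^ \<alpha> j) 0 = (\<Prod>j\<in>J. v j ^ \<alpha> j)"
        by (simp add: poly_prod poly_0_coeff_0[symmetric]) (intro prod.cong refl, simp add: poly_0_coeff_0 qr(2))
      then show ?thesis using eq k_le[OF that] by (cases "c \<alpha> = 0") auto
    qed
    have "0 = coeff G k" using \<open>G = 0\<close> by simp
    also have "\<dots> = (\<Sum>\<alpha>\<in>S. if sum \<alpha> J = k then c \<alpha> * (\<Prod>j\<in>J. v j ^ \<alpha> j) else 0)"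
      unfolding G_def coeff_sum by (intro sum.cong * refl)
    finally show ?thesis using finS by (simp add: T_def sum.inter_filter)
  qed
  moreover have "finite T" "inj_on (\<lambda>\<alpha>. restrict \<alpha> J) T"
  proof -
    show "finite T" using finS by (simp add: T_def)
    show "inj_on (\<lambda>\<alpha>. restrict \<alpha> J) T"
      by (rule inj_onI) (metis (no_types, lifting) S_def T_def mem_Collect_eq PiE_restrict)
  qed
  ultimately have "\<forall>\<alpha>\<in>T. c \<alpha> = 0" by (intro monomials_independent[OF inf J])
  then show False using \<alpha>0 by (simp add: T_def)
qed

section \<open>Leading forms of power series\<close>

lemmas mps_coeff_simps = zero_mps.rep_eq one_mps.rep_eq plus_mps.rep_eq minus_mps.rep_eq
  uminus_mps.rep_eq mps_const.rep_eq mps_var.rep_eq mps_deriv.rep_eq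

lemma mps_coeff_sum: "mps_coeff (sum g I) e = (\<Sum>i\<in>I. mps_coeff (g i :: ('k::comm_ring_1, 'n::finite) mps) e)"
  by (induction I rule: infinite_finite_induct) (auto simp: mps_coeff_simps)

definition exps :: "nat \<Rightarrow> ('n::finite \<Rightarrow> nat) set" where
  "exps d = {e. sum e UNIV = d}"

lemma finite_exps: "finite (exps d)"
proof (rule finite_subset[OF _ finite_exponents_le[of "\<lambda>_. d"]])
  show "exps d \<subseteq> {e. e \<le> (\<lambda>_. d)}"
    by (auto simp: exps_def le_fun_def member_le_sum)
qed

lemma exps_0: "exps 0 = {\<lambda>_. 0}"
  by (auto simp: exps_def)

lemma sum_exponent_unit: "sum ((\<lambda>_. 0)(k := c)) (UNIV :: 'n::finite set) = (c :: nat)"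
proof -
  have "sum ((\<lambda>_. 0)(k := c)) (UNIV :: 'n set) = (\<Sum>i\<in>UNIV. if i = k then c else 0)"
    by (intro sum.cong) auto
  then show ?thesis by simp
qed

lemma sum_exponent_Suc:
  fixes e :: "'n::finite \<Rightarrow> nat"
  shows "sum (e(j := Suc (e j))) UNIV = Suc (sum e UNIV)"
proof -
  have "sum (e(j := Suc (e j))) UNIV = (\<Sum>i\<in>UNIV. e i + (if i = j then 1 else 0))"
    by (intro sum.cong) auto
  then show ?thesis by (simp add: sum.distrib)
qed

lemma exps_1: "exps 1 = range (\<lambda>k. (\<lambda>_. 0)(k := 1))"
proof (intro equalityI subsetI)
  fix e :: "'a \<Rightarrow> nat" assume e: "e \<in> exps 1"
  then obtain k where k: "e k = 1" "\<forall>i. i \<noteq> k \<longrightarrow> e i = 0"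
    unfolding exps_def using sum_eq_1_iff[of UNIV e] by auto
  then have "e = (\<lambda>_. 0)(k := 1)" by (auto simp: fun_eq_iff)
  then show "e \<in> range (\<lambda>k. (\<lambda>_. 0)(k := 1))" by blast
qed (auto simp: exps_def sum_exponent_unit)

text \<open>A substitute for \<open>mps_ord\<close> that is stated coefficientwise and is therefore
  visibly linear; \<open>ord_ge_component\<close> makes the connection.\<close>

definition ord_ge :: "nat \<Rightarrow> ('k::comm_ring_1, 'n::finite) mps \<Rightarrow> bool" where
  "ord_ge d a \<longleftrightarrow> (\<forall>e. sum e UNIV < d \<longrightarrow> mps_coeff a e = 0)"

text \<open>The homogeneous part of degree \<open>d\<close> as a function on points. For series with
  \<open>ord_ge d\<close> this is the leading form, or zero if the order is larger. Taking values
  turns linear substitution into plain composition of functions.\<close>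

definition hom_eval :: "nat \<Rightarrow> ('k::comm_ring_1, 'n::finite) mps \<Rightarrow> ('n \<Rightarrow> 'k) \<Rightarrow> 'k" where
  "hom_eval d a x = (\<Sum>e\<in>exps d. mps_coeff a e * (\<Prod>i\<in>UNIV. x i ^ e i))"

lemma ord_ge_0: "ord_ge 0 a" by (simp add: ord_ge_def)

lemma ord_ge_zero: "ord_ge d 0" by (simp add: ord_ge_def mps_coeff_simps)

lemma ord_ge_add: "ord_ge d a \<Longrightarrow> ord_ge d b \<Longrightarrow> ord_ge d (a + b)"
  by (simp add: ord_ge_def mps_coeff_simps)

lemma ord_ge_diff: "ord_ge d a \<Longrightarrow> ord_ge d b \<Longrightarrow> ord_ge d (a - b)"
  by (simp add: ord_ge_def mps_coeff_simps)

lemma ord_ge_sum: "(\<And>i. i \<in> I \<Longrightarrow> ord_ge d (g i)) \<Longrightarrow> ord_ge d (sum g I)"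
  by (simp add: ord_ge_def mps_coeff_sum)

lemma ord_ge_mono: "ord_ge d a \<Longrightarrow> d' \<le> d \<Longrightarrow> ord_ge d' a"
  by (simp add: ord_ge_def)

lemma sum_exponent_diff:
  fixes a e :: "'n::finite \<Rightarrow> nat"
  shows "a \<le> e \<Longrightarrow> sum (e - a) UNIV = sum e UNIV - sum a UNIV"
  by (simp add: fun_diff_def le_fun_def sum_subtractf_nat)

lemma sum_exponent_le:
  fixes a e :: "'n::finite \<Rightarrow> nat"
  shows "a \<le> e \<Longrightarrow> sum a UNIV \<le> sum e UNIV"
  by (simp add: le_fun_def sum_mono)

lemma ord_ge_mult:
  assumes "ord_ge d a" "ord_ge d' b"
  shows "ord_ge (d + d') (a * b)"
  unfolding ord_ge_def
proof (intro allI impI)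
  fix e :: "'b \<Rightarrow> nat" assume e: "sum e UNIV < d + d'"
  have "mps_coeff a c * mps_coeff b (e - c) = 0" if "c \<le> e" for c
  proof (cases "sum c UNIV < d")
    case True
    then show ?thesis using assms(1) by (simp add: ord_ge_def)
  next
    case False
    then have "sum (e - c) UNIV < d'" using e sum_exponent_diff[OF that] sum_exponent_le[OF that] by linarith
    then show ?thesis using assms(2) by (simp add: ord_ge_def)
  qed
  then show "mps_coeff (a * b) e = 0" by (auto simp: times_mps.rep_eq intro!: sum.neutral)
qed

lemma ord_ge_mult_left: "ord_ge d b \<Longrightarrow> ord_ge d (a * b)"
  using ord_ge_mult[OF ord_ge_0, of d b a] by simp

lemma hom_eval_add: "hom_eval d (a + b) x = hom_eval d a x + hom_eval d b x"
  by (simp add: hom_eval_def mps_coeff_simps sum.distrib algebra_simps)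

lemma hom_eval_diff: "hom_eval d (a - b) x = hom_eval d a x - hom_eval d b x"
  by (simp add: hom_eval_def mps_coeff_simps sum_subtractf algebra_simps)

lemma hom_eval_zero: "hom_eval d 0 x = 0"
  by (simp add: hom_eval_def mps_coeff_simps)

lemma hom_eval_sum: "hom_eval d (sum g I) x = (\<Sum>i\<in>I. hom_eval d (g i) x)"
  by (induction I rule: infinite_finite_induct) (auto simp: hom_eval_add hom_eval_zero)

lemma hom_eval_0: "hom_eval 0 a x = mps_coeff a (\<lambda>_. 0)"
  by (simp add: hom_eval_def exps_0)

lemma hom_eval_1: "hom_eval 1 a x = (\<Sum>k\<in>UNIV. mps_coeff a ((\<lambda>_. 0)(k := 1)) * x k)"
proof -
  have inj: "inj (\<lambda>k::'b. (\<lambda>_. 0)(k := 1::nat))"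
    by (rule injI) (metis fun_upd_apply zero_neq_one)
  have "(\<Prod>i\<in>UNIV. x i ^ ((\<lambda>_. 0)(k := 1::nat)) i) = x k" for k
  proof -
    have "(\<Prod>i\<in>UNIV. x i ^ ((\<lambda>_. 0)(k := 1::nat)) i) = (\<Prod>i\<in>UNIV. if i = k then x i else 1)"
      by (intro prod.cong) auto
    then show ?thesis by simp
  qed
  then show ?thesis
    unfolding hom_eval_def exps_1 by (subst sum.reindex[OF inj]) simp
qed

lemma hom_eval_scale: "hom_eval d a (\<lambda>i. t * x i) = t ^ d * hom_eval d a x"
  unfolding hom_eval_def sum_distrib_left
proof (intro sum.cong refl)
  fix e :: "'b \<Rightarrow> nat" assume "e \<in> exps d"
  then have "(\<Prod>i\<in>UNIV. (t * x i) ^ e i) = t ^ d * (\<Prod>i\<in>UNIV. x i ^ e i)"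
    by (simp add: power_mult_distrib prod.distrib exps_def flip: power_sum)
  then show "mps_coeff a e * (\<Prod>i\<in>UNIV. (t * x i) ^ e i) = t ^ d * (mps_coeff a e * (\<Prod>i\<in>UNIV. x i ^ e i))"
    by (simp add: mult_ac)
qed

text \<open>If a term of degree \<open>d + d'\<close> is split in any way other than into degrees
  \<open>d\<close> and \<open>d'\<close>, one of the two factors lies below its order and
  vanishes.\<close>

lemma hom_eval_mult:
  fixes a b :: "('k::comm_ring_1, 'n::finite) mps"
  assumes "ord_ge d a" "ord_ge d' b"
  shows "hom_eval (d + d') (a * b) x = hom_eval d a x * hom_eval d' b x"
proof -
  let ?m = "\<lambda>e. \<Prod>i\<in>UNIV. x i ^ e i"
  have "hom_eval (d + d') (a * b) x
      = (\<Sum>e\<in>exps (d + d'). \<Sum>c | c \<le> e. mps_coeff a c * mps_coeff b (e - c) * ?m e)"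
    by (simp add: hom_eval_def times_mps.rep_eq sum_distrib_right)
  also have "\<dots> = (\<Sum>(e, c)\<in>Sigma (exps (d + d')) (\<lambda>e. {c. c \<le> e}). mps_coeff a c * mps_coeff b (e - c) * ?m e)"
    by (simp add: sum.Sigma finite_exps finite_exponents_le)
  also have "\<dots> = (\<Sum>(e, c)\<in>{(e, c). e \<in> exps (d + d') \<and> c \<le> e \<and> c \<in> exps d}. mps_coeff a c * mps_coeff b (e - c) * ?m e)"
  proof (intro sum.mono_neutral_right ballI)
    show "finite (Sigma (exps (d + d')) (\<lambda>e. {c. c \<le> e}))" by (intro finite_SigmaI finite_exps finite_exponents_le)
    fix p :: "('n \<Rightarrow> nat) \<times> ('n \<Rightarrow> nat)"
    assume p: "p \<in> Sigma (exps (d + d')) (\<lambda>e. {c. c \<le> e}) - {(e, c). e \<in> exps (d + d') \<and> c \<le> e \<and> c \<in> exps d}"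
    obtain e c where ec: "p = (e, c)" by force
    have e: "sum e UNIV = d + d'" "c \<le> e" "sum c UNIV \<noteq> d" using p ec by (auto simp: exps_def)
    then consider "sum c UNIV < d" | "sum (e - c) UNIV < d'"
      using sum_exponent_diff[OF e(2)] sum_exponent_le[OF e(2)] by linarith
    then have "mps_coeff a c * mps_coeff b (e - c) = 0"
      using assms by cases (auto simp: ord_ge_def)
    then show "(case p of (e, c) \<Rightarrow> mps_coeff a c * mps_coeff b (e - c) * ?m e) = 0" using ec by simp
  qed auto
  also have "\<dots> = (\<Sum>(c, c')\<in>exps d \<times> exps d'. (mps_coeff a c * ?m c) * (mps_coeff b c' * ?m c'))"
  proof (rule sum.reindex_bij_witness[where i = "\<lambda>(c, c'). (\<lambda>i. c i + c' i, c)" and j = "\<lambda>(e, c). (c, e - c)"], goal_cases)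
    case (1 p) then show ?case by (auto simp: le_fun_def fun_eq_iff)
  next
    case (2 p) then show ?case by (auto simp: exps_def le_fun_def sum_subtractf_nat)
  next
    case (3 p) then show ?case by (auto simp: le_fun_def fun_eq_iff)
  next
    case (4 p) then show ?case by (auto simp: le_fun_def exps_def sum.distrib)
  next
    case (5 p)
    obtain e c where ec: "p = (e, c)" "c \<le> e" using 5 by auto
    then have "?m e = ?m c * ?m (e - c)"
      by (auto simp: le_fun_def simp flip: prod.distrib power_add)
    then show ?case using ec by (simp add: mult_ac)
  qed
  also have "\<dots> = hom_eval d a x * hom_eval d' b x"
    by (simp add: hom_eval_def sum_product sum.cartesian_product)
  finally show ?thesis .
qed

lemma hom_eval_mult_left: "ord_ge d b \<Longrightarrow> hom_eval d (a * b) x = mps_coeff a (\<lambda>_. 0) * hom_eval d b x"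
  using hom_eval_mult[OF ord_ge_0, of d b a x] by (simp add: hom_eval_0)

lemma mps_coeff_var_mult:
  "mps_coeff (mps_var j * b) e = (if e j = 0 then 0 else mps_coeff b (e(j := e j - 1)))"
proof -
  have eq: "e - (\<lambda>_. 0)(j := 1) = e(j := e j - 1)" by (auto simp: fun_eq_iff)
  have "mps_coeff (mps_var j * b) e = (\<Sum>a | a \<le> e. if a = (\<lambda>_. 0)(j := 1) then mps_coeff b (e - a) else 0)"
    unfolding times_mps.rep_eq mps_var.rep_eq by (intro sum.cong) auto
  also have "\<dots> = (if e j = 0 then 0 else mps_coeff b (e(j := e j - 1)))"
    by (subst sum.delta[OF finite_exponents_le], unfold eq) (auto simp: le_fun_def)
  finally show ?thesis .
qed

lemma ord_ge_var: "ord_ge 1 (mps_var j)"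
  by (auto simp: ord_ge_def mps_var.rep_eq)

lemma hom_eval_var: "hom_eval 1 (mps_var j) x = x j"
proof -
  have "(\<Sum>k\<in>UNIV. mps_coeff (mps_var j) ((\<lambda>_. 0)(k := 1)) * x k) = (\<Sum>k\<in>UNIV. if k = j then x k else 0)"
    by (intro sum.cong) (auto simp: mps_var.rep_eq fun_eq_iff)
  then show ?thesis unfolding hom_eval_1 by simp
qed

text \<open>Each exponent vector is assigned by \<open>pick\<close> to one variable dividing its
  monomial; \<open>b j\<close> collects the terms of \<open>a\<close> assigned to \<open>j\<close>,
  divided by that variable. The resulting sum is finite, so additive maps can be applied to
  it.\<close>

lemma ord_ge_Suc_decomposition:
  fixes a :: "('k::comm_ring_1, 'n::finite) mps"
  assumes "ord_ge (Suc d) a"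
  obtains b where "a = (\<Sum>j\<in>UNIV. mps_var j * b j)" "\<And>j. ord_ge d (b j)"
proof -
  define pick where "pick e = (SOME j. e j \<noteq> 0)" for e :: "'n \<Rightarrow> nat"
  define b :: "'n \<Rightarrow> ('k, 'n) mps" where
    "b j = Abs_mps (\<lambda>e. if pick (e(j := Suc (e j))) = j then mps_coeff a (e(j := Suc (e j))) else 0)" for j
  have b: "mps_coeff (b j) e = (if pick (e(j := Suc (e j))) = j then mps_coeff a (e(j := Suc (e j))) else 0)" for j e
    by (simp add: b_def Abs_mps_inverse)
  have "mps_coeff a e = mps_coeff (\<Sum>j\<in>UNIV. mps_var j * b j) e" for e
  proof -
    have upd: "(e(j := e j - 1))(j := Suc ((e(j := e j - 1)) j)) = e" if "e j \<noteq> 0" for j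
      using that by (auto simp: fun_eq_iff)
    have "mps_coeff (\<Sum>j\<in>UNIV. mps_var j * b j) e = (\<Sum>j\<in>UNIV. if e j \<noteq> 0 \<and> pick e = j then mps_coeff a e else 0)"
      unfolding mps_coeff_sum mps_coeff_var_mult b by (intro sum.cong refl) (use upd in auto)
    also have "\<dots> = mps_coeff a e"
    proof (cases "\<exists>j. e j \<noteq> 0")
      case True
      then have "e (pick e) \<noteq> 0" unfolding pick_def by (rule someI_ex)
      then have "(\<Sum>j\<in>UNIV. if e j \<noteq> 0 \<and> pick e = j then mps_coeff a e else 0) = (\<Sum>j\<in>UNIV. if pick e = j then mps_coeff a e else 0)"
        by (intro sum.cong) auto
      then show ?thesis by simp
    next
      case False
      then have "sum e UNIV < Suc d" by simp
      then show ?thesis using False assms by (simp add: ord_ge_def)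
    qed
    finally show ?thesis by simp
  qed
  then have "a = (\<Sum>j\<in>UNIV. mps_var j * b j)" by (rule mps_eqI)
  moreover have "ord_ge d (b j)" for j
  proof -
    show ?thesis using assms sum_exponent_Suc[of _ j] by (auto simp: ord_ge_def b)
  qed
  ultimately show ?thesis by (rule that)
qed

lemma mps_coeff_mult_0: "mps_coeff (a * b) (\<lambda>_. 0) = mps_coeff a (\<lambda>_. 0) * mps_coeff b (\<lambda>_. 0)"
  using hom_eval_mult[OF ord_ge_0 ord_ge_0, of a b] by (simp add: hom_eval_0)

lemma ord_ge_1_iff: "ord_ge 1 a \<longleftrightarrow> mps_coeff a (\<lambda>_. 0) = 0"
  by (auto simp: ord_ge_def) (metis (no_types) ext)

text \<open>Geometric series: after division by the constant term, \<open>a\<close> becomes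
  \<open>1 - u\<close> with \<open>u\<close> of positive order. In a given degree only finitely many
  powers of \<open>u\<close> contribute, so the sum of all powers can be defined
  coefficientwise.\<close>

lemma mps_invertible:
  fixes a :: "('k::field, 'n::finite) mps"
  assumes "mps_coeff a (\<lambda>_. 0) \<noteq> 0"
  shows "\<exists>b. a * b = 1"
proof -
  define c where "c = (mps_const (inverse (mps_coeff a (\<lambda>_. 0))) :: ('k, 'n) mps)"
  define u where "u = 1 - a * c"
  have "ord_ge 1 u"
    unfolding ord_ge_1_iff using assms by (simp add: u_def c_def mps_coeff_mult_0 mps_coeff_simps)
  then have upow: "ord_ge k (u ^ k)" for k
    using ord_ge_mult[of 1 u] by (induction k) (auto simp: ord_ge_0)
  define b :: "('k, 'n) mps" where "b = Abs_mps (\<lambda>e. mps_coeff (\<Sum>k<Suc (sum e UNIV). u ^ k) e)"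
  have b: "mps_coeff b e = mps_coeff (\<Sum>k<Suc N. u ^ k) e" if "sum e UNIV \<le> N" for e N
  proof -
    have "(\<Sum>k<Suc (sum e UNIV). mps_coeff (u ^ k) e) = (\<Sum>k<Suc N. mps_coeff (u ^ k) e)"
      using that upow by (intro sum.mono_neutral_left) (auto simp: ord_ge_def)
    then show ?thesis by (simp add: b_def Abs_mps_inverse mps_coeff_sum del: sum.lessThan_Suc)
  qed
  have "mps_coeff ((1 - u) * b) e = mps_coeff 1 e" for e
  proof -
    let ?B = "\<Sum>k<Suc (sum e UNIV). u ^ k"
    have "mps_coeff ((1 - u) * b) e = mps_coeff ((1 - u) * ?B) e"
      unfolding times_mps.rep_eq
    proof (intro sum.cong refl)
      fix c assume "c \<in> {c. c \<le> e}"
      then have "mps_coeff b (e - c) = mps_coeff ?B (e - c)"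
        by (intro b) (simp add: sum_mono)
      then show "mps_coeff (1 - u) c * mps_coeff b (e - c) = mps_coeff (1 - u) c * mps_coeff ?B (e - c)"
        by simp
    qed
    also have "\<dots> = mps_coeff (1 - u ^ Suc (sum e UNIV)) e"
      by (simp only: one_diff_power_eq)
    also have "\<dots> = mps_coeff 1 e"
      using upow[of "Suc (sum e UNIV)"] by (simp add: ord_ge_def mps_coeff_simps del: power_Suc)
    finally show ?thesis .
  qed
  then have "(1 - u) * b = 1" by (rule mps_eqI)
  then have "a * (c * b) = 1" by (simp add: u_def mult.assoc)
  then show ?thesis by blast
qed

section \<open>Algebra endomorphisms and contact equivalence on leading forms\<close>

definition mps_endomorphism :: "(('k::field, 'n::finite) mps \<Rightarrow> ('k, 'n) mps) \<Rightarrow> bool" where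
  "mps_endomorphism \<psi> \<longleftrightarrow> (\<forall>a b. \<psi> (a + b) = \<psi> a + \<psi> b) \<and> (\<forall>a b. \<psi> (a * b) = \<psi> a * \<psi> b) \<and>
     (\<forall>c. \<psi> (mps_const c) = mps_const c)"

lemma mps_endomorphism_sum:
  assumes "mps_endomorphism \<psi>"
  shows "\<psi> (sum g I) = (\<Sum>i\<in>I. \<psi> (g i))"
proof -
  have add: "\<psi> (a + b) = \<psi> a + \<psi> b" for a b using assms by (simp add: mps_endomorphism_def)
  have "\<psi> 0 = 0" using add[of 0 0] by simp
  then show ?thesis by (induction I rule: infinite_finite_induct) (auto simp: add)
qed

lemma mps_endomorphism_diff:
  assumes "mps_endomorphism \<psi>"
  shows "\<psi> (a - b) = \<psi> a - \<psi> b"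
proof -
  have "\<psi> (a - b) + \<psi> b = \<psi> (a - b + b)" using assms unfolding mps_endomorphism_def by metis
  then show ?thesis by (simp add: eq_diff_eq)
qed

text \<open>Otherwise, after subtracting a constant, a unit would be mapped to a non-unit.\<close>

lemma mps_endomorphism_const_coeff:
  assumes "mps_endomorphism \<psi>"
  shows "mps_coeff (\<psi> a) (\<lambda>_. 0) = mps_coeff a (\<lambda>_. 0)"
proof (rule ccontr)
  assume neq: "mps_coeff (\<psi> a) (\<lambda>_. 0) \<noteq> mps_coeff a (\<lambda>_. 0)"
  define c where "c = mps_coeff (\<psi> a) (\<lambda>_. 0)"
  have "mps_coeff (a - mps_const c) (\<lambda>_. 0) \<noteq> 0" using neq by (simp add: mps_coeff_simps c_def)
  then obtain b where b: "(a - mps_const c) * b = 1" using mps_invertible by blast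
  have "\<psi> 1 = 1" using assms mps_const_one unfolding mps_endomorphism_def by metis
  then have "(\<psi> a - mps_const c) * \<psi> b = 1"
    using arg_cong[OF b, of \<psi>] assms mps_endomorphism_diff[OF assms] by (simp add: mps_endomorphism_def)
  then have "mps_coeff ((\<psi> a - mps_const c) * \<psi> b) (\<lambda>_. 0) = 1" by (simp add: mps_coeff_simps)
  then show False by (simp add: mps_coeff_mult_0 mps_coeff_simps c_def)
qed

text \<open>On leading forms an endomorphism acts by substituting the linear parts of the images of
  the variables. The induction splits off one variable at a time through
  \<open>ord_ge_Suc_decomposition\<close>; as only finite sums occur, no continuity has to be
  established.\<close>

lemma mps_endomorphism_leading_form:
  assumes "mps_endomorphism \<psi>" "ord_ge d a"
  shows "ord_ge d (\<psi> a) \<and>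
    (\<forall>x. hom_eval d (\<psi> a) x = hom_eval d a (\<lambda>j. hom_eval 1 (\<psi> (mps_var j)) x))"
  using assms(2)
proof (induction d arbitrary: a)
  case 0
  then show ?case using mps_endomorphism_const_coeff[OF assms(1)] by (simp add: ord_ge_0 hom_eval_0)
next
  case (Suc d)
  obtain b where b: "a = (\<Sum>j\<in>UNIV. mps_var j * b j)" "\<And>j. ord_ge d (b j)"
    using ord_ge_Suc_decomposition[OF Suc.prems] by blast
  have \<psi>a: "\<psi> a = (\<Sum>j\<in>UNIV. \<psi> (mps_var j) * \<psi> (b j))"
    using assms(1) by (simp add: b(1) mps_endomorphism_sum mps_endomorphism_def)
  have var: "ord_ge 1 (\<psi> (mps_var j))" for j
    using mps_endomorphism_const_coeff[OF assms(1)] ord_ge_var ord_ge_1_iff by metis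
  have bj: "ord_ge d (\<psi> (b j))" for j using Suc.IH[OF b(2)] by blast
  have mult: "hom_eval (Suc d) (p * q) x = hom_eval 1 p x * hom_eval d q x"
    if "ord_ge 1 p" "ord_ge d q" for p q :: "('a, 'b) mps" and x
    using hom_eval_mult[OF that] by simp
  show ?case
  proof (intro conjI allI)
    show "ord_ge (Suc d) (\<psi> a)"
      unfolding \<psi>a using ord_ge_mult[OF var bj] by (intro ord_ge_sum) simp
    fix x
    have "hom_eval (Suc d) (\<psi> a) x = (\<Sum>j\<in>UNIV. hom_eval 1 (\<psi> (mps_var j)) x * hom_eval d (\<psi> (b j)) x)"
      unfolding \<psi>a hom_eval_sum by (intro sum.cong refl mult var bj)
    also have "\<dots> = hom_eval (Suc d) a (\<lambda>j. hom_eval 1 (\<psi> (mps_var j)) x)"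
      unfolding b(1) hom_eval_sum
      by (intro sum.cong refl) (use Suc.IH b(2) in \<open>simp add: mult ord_ge_var hom_eval_var del: One_nat_def\<close>)
    finally show "hom_eval (Suc d) (\<psi> a) x = hom_eval (Suc d) a (\<lambda>j. hom_eval 1 (\<psi> (mps_var j)) x)" .
  qed
qed

text \<open>The equivalence is solved for \<open>F\<close>: apply the inverse matrix
  \<open>V\<close>, then the inverse automorphism \<open>\<psi>\<close>. Only the constant terms of
  \<open>V\<close> and the linear parts of \<open>\<psi>\<close> reach the leading forms; they give
  \<open>A\<close> and \<open>B\<close>.\<close>

lemma contact_equiv_leading_form:
  fixes F h :: "('k::field, 'n::finite) mps ^ 'm::finite"
  assumes "contact_equiv F h" and F: "\<And>i. ord_ge d (F $ i)"
  shows "\<exists>A B. \<forall>i x. hom_eval d (F $ i) x =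
    (\<Sum>l\<in>UNIV. A i l * hom_eval d (h $ l) (\<lambda>j. \<Sum>k\<in>UNIV. B j k * x k))"
proof -
  obtain U \<phi> where U: "invertible U" and \<phi>: "mps_automorphism \<phi>" and h: "h = U *v (\<chi> i. \<phi> (F $ i))"
    using assms(1) unfolding contact_equiv_def by blast
  obtain V where V: "V ** U = mat 1" using U unfolding invertible_def by blast
  define \<psi> where "\<psi> = inv \<phi>"
  have bij: "bij \<phi>" using \<phi> by (simp add: mps_automorphism_def)
  have \<psi>\<phi>: "\<psi> (\<phi> a) = a" "\<phi> (\<psi> a) = a" for a
    using bij by (simp_all add: \<psi>_def bij_is_inj bij_is_surj surj_f_inv_f)
  have \<phi>hom: "\<phi> (a + b) = \<phi> a + \<phi> b" "\<phi> (a * b) = \<phi> a * \<phi> b" "\<phi> (mps_const c) = mps_const c" for a b c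
    using \<phi> by (auto simp: mps_automorphism_def)
  have endo: "mps_endomorphism \<phi>" by (simp add: mps_endomorphism_def \<phi>hom)
  have endo': "mps_endomorphism \<psi>"
    unfolding mps_endomorphism_def by (metis \<phi>hom \<psi>\<phi>)
  have h_ord: "ord_ge d (h $ l)" for l
    unfolding h using mps_endomorphism_leading_form[OF endo F]
    by (auto simp: matrix_vector_mult_def intro!: ord_ge_sum ord_ge_mult_left)
  have "V *v h = (V ** U) *v (\<chi> i. \<phi> (F $ i))" unfolding h by (simp add: matrix_vector_mul_assoc)
  then have "(\<chi> i. \<phi> (F $ i)) = V *v h" using V by simp
  then have "\<phi> (F $ i) = (\<Sum>l\<in>UNIV. V $ i $ l * h $ l)" for i
    by (simp add: vec_eq_iff matrix_vector_mult_def)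
  then have "\<psi> (\<phi> (F $ i)) = (\<Sum>l\<in>UNIV. \<psi> (V $ i $ l) * \<psi> (h $ l))" for i
    using endo' by (simp add: mps_endomorphism_sum mps_endomorphism_def)
  then have F_eq: "F $ i = (\<Sum>l\<in>UNIV. \<psi> (V $ i $ l) * \<psi> (h $ l))" for i
    by (simp add: \<psi>\<phi>)
  have "hom_eval d (F $ i) x = (\<Sum>l\<in>UNIV. mps_coeff (V $ i $ l) (\<lambda>_. 0) *
      hom_eval d (h $ l) (\<lambda>j. \<Sum>k\<in>UNIV. mps_coeff (\<psi> (mps_var j)) ((\<lambda>_. 0)(k := 1)) * x k))" for i x
    unfolding F_eq hom_eval_sum
    using mps_endomorphism_leading_form[OF endo' h_ord]
    unfolding hom_eval_1[symmetric]
    by (intro sum.cong refl) (simp add: hom_eval_mult_left mps_endomorphism_const_coeff[OF endo'] del: One_nat_def)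
  then show ?thesis
    by (intro exI[of _ "\<lambda>i l. mps_coeff (V $ i $ l) (\<lambda>_. 0)"]
        exI[of _ "\<lambda>j k. mps_coeff (\<psi> (mps_var j)) ((\<lambda>_. 0)(k := 1))"]) blast
qed

section \<open>Tangent vectors and curves\<close>

text \<open>The coefficients belong to list positions, as in \<open>unfolding_at\<close>, so
  repeated entries of \<open>xs\<close> do no harm.\<close>

lemma module_span_list:
  fixes sc :: "'k::comm_ring_1 \<Rightarrow> 'v::ab_group_add \<Rightarrow> 'v"
  assumes "module sc" and "x \<in> module.span sc (set xs)"
  shows "\<exists>t. x = (\<Sum>i<length xs. sc (t i) (xs ! i))"
proof -
  interpret module sc by fact
  let ?T = "{x. \<exists>t. x = (\<Sum>i<length xs. sc (t i) (xs ! i))}"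
  have "subspace ?T"
  proof (rule subspaceI)
    show "0 \<in> ?T" by (auto intro!: exI[of _ "\<lambda>_. 0"])
    fix x y assume "x \<in> ?T" "y \<in> ?T"
    then obtain t u where "x = (\<Sum>i<length xs. sc (t i) (xs ! i))" "y = (\<Sum>i<length xs. sc (u i) (xs ! i))" by blast
    then show "x + y \<in> ?T" by (auto intro!: exI[of _ "\<lambda>i. t i + u i"] simp: scale_left_distrib sum.distrib)
  next
    fix c x assume "x \<in> ?T"
    then obtain t where "x = (\<Sum>i<length xs. sc (t i) (xs ! i))" by blast
    then show "sc c x \<in> ?T" by (auto intro!: exI[of _ "\<lambda>i. c * t i"] simp: scale_sum_right)
  qed
  moreover have "set xs \<subseteq> ?T"
  proof
    fix x assume "x \<in> set xs"
    then obtain n where n: "n < length xs" "x = xs ! n" by (auto simp: in_set_conv_nth)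
    have "(\<Sum>i<length xs. sc (if i = n then 1 else 0) (xs ! i)) = (\<Sum>i<length xs. if i = n then xs ! i else 0)"
      by (intro sum.cong) auto
    then show "x \<in> ?T" using n by (auto intro!: exI[of _ "\<lambda>i. if i = n then 1 else 0"])
  qed
  ultimately show ?thesis using span_minimal[of "set xs" ?T] assms(2) by blast
qed

lemma max_ideal_eq: "max_ideal = {a. ord_ge 1 a}"
proof (intro equalityI subsetI)
  fix a :: "('a, 'b) mps" assume a: "a \<in> max_ideal"
  have "module.subspace (*) {a :: ('a, 'b) mps. ord_ge 1 a}"
    by (intro module.subspaceI[OF module_mult]) (auto intro: ord_ge_zero ord_ge_add ord_ge_mult_left)
  then have "module.span (*) (range mps_var) \<subseteq> {a :: ('a, 'b) mps. ord_ge 1 a}"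
    using ord_ge_var by (intro module.span_minimal[OF module_mult]) blast
  then show "a \<in> {a. ord_ge 1 a}" using a by (auto simp: max_ideal_def ideal_gen_def)
next
  fix a :: "('a, 'b) mps" assume "a \<in> {a. ord_ge 1 a}"
  then obtain b where "a = (\<Sum>j\<in>UNIV. mps_var j * b j)"
    using ord_ge_Suc_decomposition[of 0 a] by auto
  then have "a = (\<Sum>j\<in>UNIV. b j * mps_var j)" by (simp add: mult.commute)
  then show "a \<in> max_ideal"
    unfolding max_ideal_def ideal_gen_def
    by (auto intro!: module.span_sum[OF module_mult] intro: module.span_scale[OF module_mult] module.span_base[OF module_mult])
qed

lemma ideal_smult_max_ideal_memI:
  fixes v :: "('k::field, 'n::finite) mps ^ 'm"
  assumes "\<And>i. ord_ge 1 (v $ i)"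
  shows "v \<in> ideal_smult max_ideal UNIV"
proof -
  have "v = (\<Sum>i\<in>UNIV. (v $ i) *s axis i 1)"
    by (simp add: vec_eq_iff axis_def if_distrib cong: if_cong)
  moreover have "(\<Sum>i\<in>UNIV. (v $ i) *s axis i 1) \<in> ideal_smult max_ideal UNIV"
    unfolding ideal_smult_def submod_gen_def
    by (intro module.span_sum[OF module_smult] module.span_base[OF module_smult])
      (use assms in \<open>auto simp: max_ideal_eq\<close>)
  ultimately show ?thesis by simp
qed

lemma ord_ge_deriv: "ord_ge (Suc d) a \<Longrightarrow> ord_ge d (mps_deriv j a)"
  using sum_exponent_Suc[of _ j] by (simp add: ord_ge_def mps_deriv.rep_eq)

text \<open>\<open>A\<close> and \<open>B\<close> are the velocities of linear changes of the components and of the variables.\<close>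

lemma tangent_contact_leading_form:
  fixes f :: "('k::field, 'n::finite) mps ^ 'm::finite"
  assumes f: "\<And>i. ord_ge (Suc d) (f $ i)" and "\<tau> \<in> tangent_contact f"
  shows "(\<forall>i. ord_ge (Suc d) (\<tau> $ i)) \<and>
    (\<exists>A B. \<forall>i x. hom_eval (Suc d) (\<tau> $ i) x = (\<Sum>l\<in>UNIV. A i l * hom_eval (Suc d) (f $ l) x) +
      (\<Sum>j\<in>UNIV. \<Sum>k\<in>UNIV. B j k * x k * hom_eval d (mps_deriv j (f $ i)) x))"
proof -
  let ?D = "Suc d"
  let ?form = "\<lambda>\<tau> A B. \<forall>i x. hom_eval ?D (\<tau> $ i) x = (\<Sum>l\<in>UNIV. A i l * hom_eval ?D (f $ l) x) +
      (\<Sum>j\<in>UNIV. \<Sum>k\<in>UNIV. B j k * x k * hom_eval d (mps_deriv j (f $ i)) x)"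
  \<comment> \<open>\<open>Z\<close> is the set of vectors with the asserted property. It is a
    submodule, on which a scalar series acts through its constant term, so it suffices that
    \<open>Z\<close> contains the generators of both summands of the tangent space.\<close>
  define Z where "Z = {\<tau> :: ('k, 'n) mps ^ 'm. (\<forall>i. ord_ge ?D (\<tau> $ i)) \<and> (\<exists>A B. ?form \<tau> A B)}"
  have subZ: "module.subspace (*s) Z"
  proof (rule module.subspaceI[OF module_smult])
    show "0 \<in> Z"
      by (auto simp: Z_def ord_ge_zero hom_eval_zero intro!: exI[of _ "\<lambda>_ _. 0"])
  next
    fix \<sigma> \<tau> :: "('k, 'n) mps ^ 'm"
    assume *: "\<sigma> \<in> Z" "\<tau> \<in> Z"
    then obtain A B A' B' where "?form \<sigma> A B" "?form \<tau> A' B'" unfolding Z_def by blast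
    then have "?form (\<sigma> + \<tau>) (\<lambda>i l. A i l + A' i l) (\<lambda>j k. B j k + B' j k)"
      by (simp add: hom_eval_add sum.distrib algebra_simps)
    moreover have "\<forall>i. ord_ge ?D ((\<sigma> + \<tau>) $ i)" using * by (simp add: Z_def ord_ge_add)
    ultimately show "\<sigma> + \<tau> \<in> Z"
      unfolding Z_def mem_Collect_eq by (intro conjI exI)
  next
    fix r :: "('k, 'n) mps" and \<tau> :: "('k, 'n) mps ^ 'm"
    assume *: "\<tau> \<in> Z"
    then obtain A B where AB: "?form \<tau> A B" unfolding Z_def by blast
    let ?r = "mps_coeff r (\<lambda>_. 0)"
    have "?form (r *s \<tau>) (\<lambda>i l. ?r * A i l) (\<lambda>j k. ?r * B j k)"
      using * AB by (simp add: Z_def hom_eval_mult_left sum_distrib_left algebra_simps)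
    moreover have "\<forall>i. ord_ge ?D ((r *s \<tau>) $ i)" using * by (simp add: Z_def ord_ge_mult_left)
    ultimately show "r *s \<tau> \<in> Z"
        unfolding Z_def mem_Collect_eq by (intro conjI exI)
  qed
  have "ideal_smult (comp_ideal f) UNIV \<subseteq> Z"
  proof -
    \<comment> \<open>The corresponding ideal for the first summand: its elements contribute the
      component part \<open>A\<close>, with zero \<open>B\<close>.\<close>
    define I where "I = {a :: ('k, 'n) mps. ord_ge ?D a \<and>
        (\<exists>\<alpha>. \<forall>x. hom_eval ?D a x = (\<Sum>l\<in>UNIV. \<alpha> l * hom_eval ?D (f $ l) x))}"
    have "module.subspace (*) I"
    proof (rule module.subspaceI[OF module_mult])
      show "0 \<in> I"
        by (auto simp: I_def ord_ge_zero hom_eval_zero intro!: exI[of _ "\<lambda>_. 0"])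
    next
      fix a b :: "('k, 'n) mps"
      assume *: "a \<in> I" "b \<in> I"
      then obtain \<alpha> \<beta> where "\<forall>x. hom_eval ?D a x = (\<Sum>l\<in>UNIV. \<alpha> l * hom_eval ?D (f $ l) x)"
        "\<forall>x. hom_eval ?D b x = (\<Sum>l\<in>UNIV. \<beta> l * hom_eval ?D (f $ l) x)" unfolding I_def by blast
      then have "\<forall>x. hom_eval ?D (a + b) x = (\<Sum>l\<in>UNIV. (\<alpha> l + \<beta> l) * hom_eval ?D (f $ l) x)"
        by (simp add: hom_eval_add sum.distrib algebra_simps)
      moreover have "ord_ge ?D (a + b)" using * by (simp add: I_def ord_ge_add)
      ultimately show "a + b \<in> I" unfolding I_def mem_Collect_eq by (intro conjI exI)
    next
      fix r a :: "('k, 'n) mps"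
      assume *: "a \<in> I"
      then obtain \<alpha> where "\<forall>x. hom_eval ?D a x = (\<Sum>l\<in>UNIV. \<alpha> l * hom_eval ?D (f $ l) x)" unfolding I_def by blast
      then have "\<forall>x. hom_eval ?D (r * a) x = (\<Sum>l\<in>UNIV. (mps_coeff r (\<lambda>_. 0) * \<alpha> l) * hom_eval ?D (f $ l) x)"
        using * by (simp add: I_def hom_eval_mult_left sum_distrib_left mult.assoc)
      moreover have "ord_ge ?D (r * a)" using * by (simp add: I_def ord_ge_mult_left)
      ultimately show "r * a \<in> I" unfolding I_def mem_Collect_eq by (intro conjI exI)
    qed
    moreover have "range (($) f) \<subseteq> I"
    proof
      fix a assume "a \<in> range (($) f)"
      then obtain l where l: "a = f $ l" by blast
      have "(\<Sum>m\<in>UNIV. (if m = l then 1 else 0) * hom_eval ?D (f $ m) x) = hom_eval ?D (f $ l) x" for x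
        by (simp add: if_distrib[of "\<lambda>c. c * _"] cong: if_cong)
      then show "a \<in> I" unfolding I_def l using f
        by (auto intro!: exI[of _ "\<lambda>m. if m = l then 1 else 0"])
    qed
    ultimately have "comp_ideal f \<subseteq> I"
      unfolding comp_ideal_def ideal_gen_def by (intro module.span_minimal[OF module_mult])
    moreover have "a *s v \<in> Z" if "a \<in> I" for a and v :: "('k, 'n) mps ^ 'm"
    proof -
      obtain \<alpha> where \<alpha>: "ord_ge ?D a" "\<forall>x. hom_eval ?D a x = (\<Sum>l\<in>UNIV. \<alpha> l * hom_eval ?D (f $ l) x)"
        using \<open>a \<in> I\<close> unfolding I_def by blast
      have "hom_eval ?D (a * (v $ i)) x = (\<Sum>l\<in>UNIV. mps_coeff (v $ i) (\<lambda>_. 0) * \<alpha> l * hom_eval ?D (f $ l) x)" for i x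
        using \<alpha> by (subst mult.commute) (simp add: hom_eval_mult_left sum_distrib_left mult.assoc)
      then have "?form (a *s v) (\<lambda>i l. mps_coeff (v $ i) (\<lambda>_. 0) * \<alpha> l) (\<lambda>_ _. 0)" by simp
      moreover have "\<forall>i. ord_ge ?D ((a *s v) $ i)"
        using \<alpha>(1) by (simp add: mult.commute[of a] ord_ge_mult_left)
      ultimately show ?thesis unfolding Z_def mem_Collect_eq by (intro conjI exI)
    qed
    ultimately show ?thesis
      unfolding ideal_smult_def submod_gen_def
      by (intro module.span_minimal[OF module_smult _ subZ]) blast
  qed
  moreover have "ideal_smult max_ideal (submod_gen (range (\<lambda>j. \<chi> i. mps_deriv j (f $ i)))) \<subseteq> Z"
  proof -
    \<comment> \<open>Derivatives only have order \<open>d\<close>; the missing degree comes from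
      the factor in \<open>max_ideal\<close>, whose linear part supplies the \<open>x k\<close> in
      the \<open>B\<close> part.\<close>
    define V where "V = {v :: ('k, 'n) mps ^ 'm. (\<forall>i. ord_ge d (v $ i)) \<and>
        (\<exists>\<gamma>. \<forall>i x. hom_eval d (v $ i) x = (\<Sum>j\<in>UNIV. \<gamma> j * hom_eval d (mps_deriv j (f $ i)) x))}"
    have "module.subspace (*s) V"
    proof (rule module.subspaceI[OF module_smult])
      show "0 \<in> V"
        by (auto simp: V_def ord_ge_zero hom_eval_zero intro!: exI[of _ "\<lambda>_. 0"])
    next
      fix v w :: "('k, 'n) mps ^ 'm"
      assume *: "v \<in> V" "w \<in> V"
      then obtain \<alpha> \<beta> where "\<forall>i x. hom_eval d (v $ i) x = (\<Sum>j\<in>UNIV. \<alpha> j * hom_eval d (mps_deriv j (f $ i)) x)"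
        "\<forall>i x. hom_eval d (w $ i) x = (\<Sum>j\<in>UNIV. \<beta> j * hom_eval d (mps_deriv j (f $ i)) x)" unfolding V_def by blast
      then have "\<forall>i x. hom_eval d ((v + w) $ i) x = (\<Sum>j\<in>UNIV. (\<alpha> j + \<beta> j) * hom_eval d (mps_deriv j (f $ i)) x)"
        by (simp add: hom_eval_add sum.distrib algebra_simps)
      moreover have "\<forall>i. ord_ge d ((v + w) $ i)" using * by (simp add: V_def ord_ge_add)
      ultimately show "v + w \<in> V" unfolding V_def mem_Collect_eq by (intro conjI exI)
    next
      fix r :: "('k, 'n) mps" and v :: "('k, 'n) mps ^ 'm"
      assume *: "v \<in> V"
      then obtain \<alpha> where "\<forall>i x. hom_eval d (v $ i) x = (\<Sum>j\<in>UNIV. \<alpha> j * hom_eval d (mps_deriv j (f $ i)) x)"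
        unfolding V_def by blast
      then have "\<forall>i x. hom_eval d ((r *s v) $ i) x =
          (\<Sum>j\<in>UNIV. (mps_coeff r (\<lambda>_. 0) * \<alpha> j) * hom_eval d (mps_deriv j (f $ i)) x)"
        using * by (simp add: V_def hom_eval_mult_left sum_distrib_left mult.assoc)
      moreover have "\<forall>i. ord_ge d ((r *s v) $ i)" using * by (simp add: V_def ord_ge_mult_left)
      ultimately show "r *s v \<in> V" unfolding V_def mem_Collect_eq by (intro conjI exI)
    qed
    moreover have "range (\<lambda>j. \<chi> i. mps_deriv j (f $ i)) \<subseteq> V"
    proof
      fix v assume "v \<in> range (\<lambda>j. \<chi> i. mps_deriv j (f $ i))"
      then obtain l where l: "v = (\<chi> i. mps_deriv l (f $ i))" by blast
      have "(\<Sum>j\<in>UNIV. (if j = l then 1 else 0) * hom_eval d (mps_deriv j (f $ i)) x) = hom_eval d (mps_deriv l (f $ i)) x" for i x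
        by (simp add: if_distrib[of "\<lambda>c. c * _"] cong: if_cong)
      then show "v \<in> V" unfolding V_def l using f
        by (auto intro!: exI[of _ "\<lambda>m. if m = l then 1 else 0"] ord_ge_deriv)
    qed
    ultimately have "submod_gen (range (\<lambda>j. \<chi> i. mps_deriv j (f $ i))) \<subseteq> V"
      unfolding submod_gen_def by (intro module.span_minimal[OF module_smult])
    moreover have "a *s v \<in> Z" if "a \<in> max_ideal" "v \<in> V" for a v
    proof -
      obtain \<gamma> where \<gamma>: "\<And>i. ord_ge d (v $ i)"
        "\<And>i x. hom_eval d (v $ i) x = (\<Sum>j\<in>UNIV. \<gamma> j * hom_eval d (mps_deriv j (f $ i)) x)"
        using \<open>v \<in> V\<close> unfolding V_def by blast
      have a: "ord_ge 1 a" using that by (simp add: max_ideal_eq)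
      have "hom_eval ?D (a * (v $ i)) x = (\<Sum>j\<in>UNIV. \<Sum>k\<in>UNIV. (\<gamma> j * mps_coeff a ((\<lambda>_. 0)(k := 1))) * x k *
          hom_eval d (mps_deriv j (f $ i)) x)" for i x
      proof -
        have "hom_eval ?D (a * (v $ i)) x = hom_eval 1 a x * hom_eval d (v $ i) x"
          using hom_eval_mult[OF a \<gamma>(1)] by simp
        also have "\<dots> = (\<Sum>j\<in>UNIV. \<Sum>k\<in>UNIV. (\<gamma> j * mps_coeff a ((\<lambda>_. 0)(k := 1))) * x k *
          hom_eval d (mps_deriv j (f $ i)) x)"
          unfolding hom_eval_1 \<gamma>(2) sum_product by (subst sum.swap) (simp add: mult_ac)
        finally show ?thesis .
      qed
      then have "?form (a *s v) (\<lambda>_ _. 0) (\<lambda>j k. \<gamma> j * mps_coeff a ((\<lambda>_. 0)(k := 1)))" by simp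
      moreover have "\<forall>i. ord_ge ?D ((a *s v) $ i)"
        using ord_ge_mult[OF a \<gamma>(1)] by simp
      ultimately show ?thesis unfolding Z_def mem_Collect_eq by (intro conjI exI)
    qed
    ultimately show ?thesis
      unfolding ideal_smult_def submod_gen_def
      by (intro module.span_minimal[OF module_smult _ subZ]) blast
  qed
  ultimately have "\<tau> \<in> Z"
    using assms(2) module.subspace_add[OF module_smult subZ]
    unfolding tangent_contact_def by (auto elim!: set_plus_elim)
  then show ?thesis unfolding Z_def by blast
qed

section \<open>Forms and parameter spaces along lines\<close>

lemma coeff_mult_1: "coeff (p * q) 1 = coeff p 0 * coeff q 1 + coeff p 1 * coeff q 0"
  by (simp add: coeff_mult)

lemma pderiv_sum: "pderiv (sum g I) = (\<Sum>i\<in>I. pderiv (g i))"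
  by (induction I rule: infinite_finite_induct) (auto simp: pderiv_add)

text \<open>Taylor expansion of a form to first order along a line. It is computed with formal
  derivatives and so holds in every characteristic.\<close>

lemma hom_eval_line:
  fixes a :: "('k::field, 'n::finite) mps"
  shows "\<exists>q. (\<forall>s. poly q s = hom_eval (Suc d) a (\<lambda>i. p i + s * w i)) \<and>
    coeff q 0 = hom_eval (Suc d) a p \<and> coeff q 1 = (\<Sum>j\<in>UNIV. w j * hom_eval d (mps_deriv j a) p)"
proof -
  define q where "q = (\<Sum>e\<in>exps (Suc d). smult (mps_coeff a e) (\<Prod>i\<in>UNIV. [:p i, w i:] ^ e i))"
  \<comment> \<open>The derivative of a monomial by its variable \<open>j\<close>, up to the factor
    \<open>e j\<close>. The truncated \<open>e j - 1\<close> is harmless, since that factor vanishes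
    when \<open>e j = 0\<close>.\<close>
  let ?m = "\<lambda>e j. p j ^ (e j - 1) * (\<Prod>i\<in>UNIV - {j}. p i ^ e i)"
  have ev: "poly q s = hom_eval (Suc d) a (\<lambda>i. p i + s * w i)" for s
    by (simp add: q_def hom_eval_def poly_sum poly_prod mult.commute)
  have "coeff q 0 = hom_eval (Suc d) a p"
    using ev[of 0] by (simp add: poly_0_coeff_0)
  moreover have "coeff q 1 = (\<Sum>j\<in>UNIV. w j * hom_eval d (mps_deriv j a) p)"
  proof -
    have deriv: "(\<Sum>e\<in>exps (Suc d). mps_coeff a e * (of_nat (e j) * ?m e j)) = hom_eval d (mps_deriv j a) p" for j
    proof -
      have "(\<Sum>e\<in>exps (Suc d). mps_coeff a e * (of_nat (e j) * ?m e j))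
          = (\<Sum>e\<in>{e\<in>exps (Suc d). e j \<noteq> 0}. mps_coeff a e * (of_nat (e j) * ?m e j))"
        by (intro sum.mono_neutral_right finite_exps) auto
      also have "\<dots> = (\<Sum>e\<in>exps d. of_nat (Suc (e j)) * mps_coeff a (e(j := Suc (e j))) * (\<Prod>i\<in>UNIV. p i ^ e i))"
      proof (rule sum.reindex_bij_witness[where i = "\<lambda>e. e(j := Suc (e j))" and j = "\<lambda>e. e(j := e j - 1)"], goal_cases)
        case (1 e) then show ?case by (auto simp: fun_eq_iff)
      next
        case (2 e)
        then have "e = (e(j := e j - 1))(j := Suc ((e(j := e j - 1)) j))" by (auto simp: fun_eq_iff)
        then have "sum e UNIV = Suc (sum (e(j := e j - 1)) UNIV)" using sum_exponent_Suc by metis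
        then show ?case using 2 by (simp add: exps_def)
      next
        case (3 e) then show ?case by (auto simp: fun_eq_iff)
      next
        case (4 e) then show ?case using sum_exponent_Suc[of e j] by (simp add: exps_def)
      next
        case (5 e)
        then have upd: "(e(j := e j - 1))(j := Suc ((e(j := e j - 1)) j)) = e" "Suc ((e(j := e j - 1)) j) = e j"
          by (auto simp: fun_eq_iff)
        have "(\<Prod>i\<in>UNIV - {j}. p i ^ (e(j := e j - 1)) i) = (\<Prod>i\<in>UNIV - {j}. p i ^ e i)"
          by (intro prod.cong) auto
        then have "(\<Prod>i\<in>UNIV. p i ^ (e(j := e j - 1)) i) = ?m e j"
          by (subst prod.remove[of _ j]) auto
        then show ?case unfolding upd by (simp add: mult_ac)
      qed
      finally show ?thesis by (simp add: hom_eval_def mps_deriv.rep_eq)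
    qed
    have "coeff q 1 = poly (pderiv q) 0" by (simp add: poly_0_coeff_0 coeff_pderiv)
    also have "\<dots> = (\<Sum>e\<in>exps (Suc d). mps_coeff a e * (\<Sum>j\<in>UNIV. w j * (of_nat (e j) * ?m e j)))"
      by (simp add: q_def pderiv_sum pderiv_smult pderiv_prod pderiv_power pderiv_pCons poly_sum poly_prod mult_ac)
    also have "\<dots> = (\<Sum>j\<in>UNIV. \<Sum>e\<in>exps (Suc d). mps_coeff a e * (w j * (of_nat (e j) * ?m e j)))"
      unfolding sum_distrib_left by (rule sum.swap)
    also have "\<dots> = (\<Sum>j\<in>UNIV. w j * hom_eval d (mps_deriv j a) p)"
      unfolding deriv[symmetric] sum_distrib_left by (simp add: mult_ac)
    finally show ?thesis .
  qed
  ultimately show ?thesis using ev by blast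
qed

text \<open>The values at \<open>P\<close> serve as coordinates on the forms of degree
  \<open>d\<close>. Over an infinite field the monomials of degree \<open>d\<close> are independent
  as functions, so \<open>interpolation_points\<close> applies to them.\<close>

lemma form_interpolation:
  assumes "infinite (UNIV :: 'k::field set)"
  obtains P :: "('n::finite \<Rightarrow> 'k::field) set" where "finite P" "card P = card (exps d :: ('n::finite \<Rightarrow> nat) set)"
    "\<And>v. \<exists>g. ord_ge d g \<and> (\<forall>p\<in>P. hom_eval d g p = v p)"
proof -
  let ?E = "exps d :: ('n \<Rightarrow> nat) set"
  let ?m = "\<lambda>e x. \<Prod>i\<in>UNIV. x i ^ e i :: 'k"
  have "\<forall>e\<in>?E. c e = 0" if "\<And>x. (\<Sum>e\<in>?E. c e * ?m e x) = 0" for c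
    by (rule monomials_independent[OF assms, of UNIV]) (use that in \<open>auto simp: finite_exps inj_on_def restrict_def fun_eq_iff\<close>)
  then obtain P where P: "finite P" "card P = card ?E" "\<And>v. \<exists>c. \<forall>p\<in>P. (\<Sum>e\<in>?E. c e * ?m e p) = v p"
    using interpolation_points[where E = ?E and m = ?m, OF finite_exps] by blast
  have "\<exists>g. ord_ge d g \<and> (\<forall>p\<in>P. hom_eval d g p = v p)" for v
  proof -
    obtain c where c: "\<forall>p\<in>P. (\<Sum>e\<in>?E. c e * ?m e p) = v p" using P(3) by blast
    define g :: "('k, 'n) mps" where "g = Abs_mps (\<lambda>e. if e \<in> exps d then c e else 0)"
    have "mps_coeff g e = (if e \<in> exps d then c e else 0)" for e
      by (simp add: g_def Abs_mps_inverse)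
    then have "ord_ge d g" "\<forall>p\<in>P. hom_eval d g p = v p"
      using c by (auto simp: ord_ge_def hom_eval_def exps_def)
    then show ?thesis by blast
  qed
  with P(1,2) show ?thesis by (rule that)
qed

lemma eval_mpoly_line:
  "\<exists>G. \<forall>s. poly G s = eval_mpoly p (\<lambda>i. s * t i)"
proof (intro exI allI)
  show "poly (\<Sum>e\<in>Poly_Mapping.keys p. smult (Poly_Mapping.lookup p e)
      (\<Prod>i\<in>Poly_Mapping.keys e. [:0, t i:] ^ Poly_Mapping.lookup e i)) s = eval_mpoly p (\<lambda>i. s * t i)" for s
    by (simp add: eval_mpoly_def poly_sum poly_prod)
qed

text \<open>Some polynomial among those defining the complement is nonzero at the origin. Restricted
  to the line it is a nonzero polynomial in \<open>s\<close>, and the excluded parameters are among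
  its roots.\<close>

lemma zariski_open_line:
  assumes "zariski_open d U" "(\<lambda>_. 0) \<in> U" "t \<in> affine_space d"
  shows "finite {s. (\<lambda>i. s * t i) \<notin> U}"
proof -
  obtain P where U: "U = affine_space d - {t. \<forall>p\<in>P. eval_mpoly p t = 0}"
    using assms(1) unfolding zariski_open_def by blast
  then obtain p where p: "p \<in> P" "eval_mpoly p (\<lambda>_. 0) \<noteq> 0" using assms(2) by blast
  obtain G where G: "\<And>s. poly G s = eval_mpoly p (\<lambda>i. s * t i)" using eval_mpoly_line[of p t] by blast
  have "poly G 0 \<noteq> 0" using p(2) by (simp add: G)
  then have "finite {s. poly G s = 0}" by (intro poly_roots_finite) auto
  moreover have "{s. (\<lambda>i. s * t i) \<notin> U} \<subseteq> {s. poly G s = 0}"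
    using p(1) assms(3) by (auto simp: U G affine_space_def)
  ultimately show ?thesis by (rule finite_subset[rotated])
qed

text \<open>
  Parameters \<open>z\<close> of a linear contact transformation: \<open>z (True, i, l)\<close> are the entries of the matrix
  acting on the components and \<open>z (False, j, k)\<close> those of the linear substitution.
\<close>

definition lin_contact :: "nat \<Rightarrow> ('k::field, 'n::finite) mps ^ 'n \<Rightarrow> (bool \<times> 'n \<times> 'n \<Rightarrow> 'k) \<Rightarrow> 'n \<Rightarrow> ('n \<Rightarrow> 'k) \<Rightarrow> 'k" where
  "lin_contact d h z i x =
     (\<Sum>l\<in>UNIV. z (True, i, l) * hom_eval d (h $ l) (\<lambda>j. \<Sum>k\<in>UNIV. z (False, j, k) * x k))"

text \<open>
  Homogeneity makes one of the \<open>2n\<^sup>2\<close> parameters redundant: a nonzero entry of the substitution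
  can be scaled to \<open>1\<close>.
\<close>

lemma lin_contact_normalized:
  assumes "d > 0"
  shows "\<exists>jk z'. \<forall>i x. lin_contact d h z i x = lin_contact d h (z'((False, jk) := 1)) i x"
proof (cases "\<exists>jk. z (False, jk) \<noteq> 0")
  case False
  have "hom_eval d (h $ l) (\<lambda>j. 0) = 0" for l
    using hom_eval_scale[of d "h $ l" 0 "\<lambda>_. 0"] assms by (simp add: zero_power)
  then show ?thesis using False
    by (intro exI[of _ undefined] exI[of _ "\<lambda>_. 0"]) (simp add: lin_contact_def)
next
  case True
  then obtain jk where jk: "z (False, jk) \<noteq> 0" by blast
  define b where "b = z (False, jk)"
  define z' where "z' y = (if fst y then z y * b ^ d else z y / b)" for y
  have z': "z'((False, jk) := 1) = z'" using jk by (auto simp: z'_def b_def fun_eq_iff)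
  have "hom_eval d (h $ l) (\<lambda>j. \<Sum>k\<in>UNIV. z (False, j, k) * x k)
      = b ^ d * hom_eval d (h $ l) (\<lambda>j. \<Sum>k\<in>UNIV. z' (False, j, k) * x k)" for l x
    unfolding hom_eval_scale[symmetric] using jk by (simp add: z'_def b_def sum_distrib_left)
  then have "lin_contact d h z i x = lin_contact d h (z'((False, jk) := 1)) i x" for i x
    unfolding z' by (simp add: lin_contact_def) (simp add: z'_def mult_ac)
  then show ?thesis by blast
qed

text \<open>The 1 in the bound comes from the matrix entry, the \<open>d\<close> from the linear
  forms substituted into a monomial of degree \<open>d\<close>. The entry \<open>y\<close> is fixed,
  which removes one variable.\<close>

lemma lin_contact_poly_in:
  fixes h :: "('k::field, 'n::finite) mps ^ 'n"
  shows "poly_in (UNIV - {y}) (1 + d) (\<lambda>z. lin_contact d h (z(y := 1)) i x)"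
proof -
  have var: "poly_in (UNIV - {y}) 1 (\<lambda>z :: bool \<times> 'n \<times> 'n \<Rightarrow> 'k. (z(y := 1)) y')" for y'
    by (cases "y' = y") (auto intro: poly_in_const poly_in_var)
  have lin: "poly_in (UNIV - {y}) 1 (\<lambda>z. \<Sum>k\<in>UNIV. (z(y := 1)) (False, j, k) * x k)" for j
    using poly_in_mult[OF var poly_in_const[of _ 0]] by (intro poly_in_sum) simp
  have mono: "poly_in (UNIV - {y}) d
      (\<lambda>z. c * (\<Prod>j\<in>UNIV. (\<Sum>k\<in>UNIV. (z(y := 1)) (False, j, k) * x k) ^ e j))"
    if "e \<in> exps d" for c and e :: "'n \<Rightarrow> nat"
  proof -
    have "poly_in (UNIV - {y}) (0 + (\<Sum>j\<in>UNIV. e j * 1))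
      (\<lambda>z. c * (\<Prod>j\<in>UNIV. (\<Sum>k\<in>UNIV. (z(y := 1)) (False, j, k) * x k) ^ e j))"
      by (intro poly_in_mult poly_in_prod poly_in_power lin poly_in_const)
    then show ?thesis using that by (simp add: exps_def)
  qed
  show ?thesis
    unfolding lin_contact_def hom_eval_def
    by (intro poly_in_sum poly_in_mult var mono)
qed

text \<open>Both matrices multiply, in opposite orders: on components \<open>z'\<close> acts after
  \<open>z\<close>, whereas its substitution is carried out first on the point.\<close>

lemma lin_contact_compose:
  assumes "\<And>i x. hom_eval d (F $ i) x = lin_contact d h z i x"
  shows "\<exists>z''. \<forall>i x. lin_contact d F z' i x = lin_contact d h z'' i x"
proof -
  define z'' where "z'' y = (case y of (t, i, k) \<Rightarrow>
    if t then (\<Sum>l\<in>UNIV. z' (True, i, l) * z (True, l, k)) else (\<Sum>l\<in>UNIV. z (False, i, l) * z' (False, l, k)))" for y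
  have sub: "(\<Sum>k\<in>UNIV. z (False, j, k) * (\<Sum>m\<in>UNIV. z' (False, k, m) * x m)) = (\<Sum>m\<in>UNIV. z'' (False, j, m) * x m)" for j x
    unfolding z''_def sum_distrib_left prod.case if_False sum_distrib_right
    by (subst sum.swap) (simp add: mult.assoc)
  have "lin_contact d F z' i x = lin_contact d h z'' i x" for i x
  proof -
    have "lin_contact d F z' i x = (\<Sum>l\<in>UNIV. z' (True, i, l) * (\<Sum>m\<in>UNIV. z (True, l, m) *
        hom_eval d (h $ m) (\<lambda>j. \<Sum>m\<in>UNIV. z'' (False, j, m) * x m)))"
      unfolding lin_contact_def[of d F] assms unfolding lin_contact_def sub ..
    also have "\<dots> = lin_contact d h z'' i x"
      unfolding lin_contact_def sum_distrib_left
      by (subst sum.swap) (simp add: z''_def sum_distrib_right mult.assoc)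
    finally show ?thesis .
  qed
  then show ?thesis by blast
qed

lemma contact_equiv_lin_contact:
  fixes F h :: "('k::field, 'n::finite) mps ^ 'n"
  assumes "contact_equiv F h" "\<And>i. ord_ge d (F $ i)"
  shows "\<exists>z. \<forall>i x. hom_eval d (F $ i) x = lin_contact d h z i x"
proof -
  obtain A B where "\<forall>i x. hom_eval d (F $ i) x =
    (\<Sum>l\<in>UNIV. A i l * hom_eval d (h $ l) (\<lambda>j. \<Sum>k\<in>UNIV. B j k * x k))"
    using contact_equiv_leading_form[OF assms] by blast
  then show ?thesis unfolding lin_contact_def
    by (intro exI[of _ "\<lambda>(t, i, l). if t then A i l else B i l"]) simp
qed

section \<open>Modality of the leading form\<close>

lemma unfolding_at_line:
  "unfolding_at f gs (\<lambda>i. s * t i) $ i =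
    f $ i + mps_const s * (\<Sum>j<length gs. kscale_vec (t j) (gs ! j)) $ i"
  by (simp add: unfolding_at_def kscale_vec_def mps_const_mult sum_distrib_left mult.assoc)

text \<open>Multiplied by \<open>n\<close>, the assumption \<open>card\<close> says that
  \<open>n\<close>-tuples of forms have at least \<open>2 * n * n\<close> coordinates, one more than
  the parameters left after normalization. This is the strict inequality that
  \<open>algebraic_dependence\<close> requires.\<close>

lemma infinitely_many_leading_forms:
  fixes f :: "('k::field, 'n::finite) mps ^ 'n"
  assumes inf: "infinite (UNIV :: 'k set)"
    and f: "\<And>i. ord_ge (Suc d) (f $ i)"
    and card: "2 * CARD('n) \<le> card (exps (Suc d) :: ('n \<Rightarrow> nat) set)"
  shows "\<not> simple f"
proof
  let ?D = "Suc d"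
  assume "simple f"
  then obtain gs H U where gs: "T1sec_generators f gs" and H: "finite H"
    and U: "zariski_open (length gs) U" "(\<lambda>_. 0) \<in> U"
    and cover: "\<And>t. t \<in> U \<Longrightarrow> \<exists>h\<in>H. contact_equiv (unfolding_at f gs t) h"
    unfolding simple_def by blast
  obtain P :: "('n \<Rightarrow> 'k) set" where P: "finite P" "card P = card (exps ?D :: ('n \<Rightarrow> nat) set)"
    "\<And>v. \<exists>g. ord_ge ?D g \<and> (\<forall>p\<in>P. hom_eval ?D g p = v p)"
    using form_interpolation[OF inf] by metis
  define J where "J = (UNIV :: 'n set) \<times> P"
  have finJ: "finite J" using P(1) by (simp add: J_def)
  \<comment> \<open>One parametrization for each \<open>h\<close> and each entry of the substitution
    that may have been scaled to 1.\<close>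
  define Q where "Q = H \<times> (UNIV :: ('n \<times> 'n) set)"
  have finQ: "finite Q" using H by (simp add: Q_def)
  \<comment> \<open>The coordinates are centred at the leading form of \<open>f\<close>, so that the
    curves below start at the origin.\<close>
  define \<Phi> where "\<Phi> q j z = lin_contact ?D (fst q) (z((False, snd q) := 1)) (fst j) (snd j) - hom_eval ?D (f $ fst j) (snd j)"
    for q j and z :: "bool \<times> 'n \<times> 'n \<Rightarrow> 'k"
  have dim: "card (UNIV - {(False, snd q)} :: (bool \<times> 'n \<times> 'n) set) < card J"
    for q :: "(('k, 'n) mps ^ 'n) \<times> 'n \<times> 'n"
  proof -
    have "CARD(bool \<times> 'n \<times> 'n) = 2 * (CARD('n) * CARD('n))" by simp
    also have "\<dots> \<le> card J" using mult_le_mono2[OF card, of "CARD('n)"] P(2) by (simp add: J_def card_cartesian_product mult_ac)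
    finally show ?thesis by (rule less_le_trans[rotated]) (intro psubset_card_mono, auto)
  qed
  have poly: "poly_in (UNIV - {(False, snd q)}) (1 + ?D) (\<Phi> q j)" for q j
    using poly_in_add[OF lin_contact_poly_in poly_in_const[of _ _ "- hom_eval ?D (f $ fst j) (snd j)"]]
    by (simp add: \<Phi>_def[abs_def])
  obtain E c where c: "\<exists>\<alpha>\<in>PiE J (\<lambda>_. {..E}). c \<alpha> \<noteq> 0"
    and rel: "\<And>q z. q \<in> Q \<Longrightarrow> (\<Sum>\<alpha>\<in>PiE J (\<lambda>_. {..E}). c \<alpha> * (\<Prod>j\<in>J. \<Phi> q j z ^ \<alpha> j)) = 0"
    using algebraic_dependence[where Q = Q and \<Phi> = \<Phi> and X = "\<lambda>q. UNIV - {(False, snd q)}" and C = "1 + ?D",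
        OF finJ finQ dim poly] by blast
  show False
  proof (rule no_relation_along_all_directions[OF inf finJ c])
    fix v :: "'n \<times> ('n \<Rightarrow> 'k) \<Rightarrow> 'k"
    have "\<forall>i. \<exists>g. ord_ge ?D g \<and> (\<forall>p\<in>P. hom_eval ?D g p = v (i, p))"
      by (intro allI P(3))
    from choice[OF this] obtain g :: "'n \<Rightarrow> ('k, 'n) mps"
      where g: "\<And>i. ord_ge ?D (g i)" "\<And>i p. p \<in> P \<Longrightarrow> hom_eval ?D (g i) p = v (i, p)"
      by blast
    have "(\<chi> i. g i) \<in> ideal_smult max_ideal UNIV"
      by (intro ideal_smult_max_ideal_memI) (simp add: ord_ge_mono[OF g(1)])
    then have "(\<chi> i. g i) \<in> module.span kscale_vec (set gs) + tangent_contact f"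
      using gs by (simp add: T1sec_generators_def)
    \<comment> \<open>Transversality: a tuple \<open>g\<close> with the prescribed velocity
      \<open>v\<close> is split into a direction \<open>\<sigma>\<close> of the unfolding and a
      vector \<open>\<tau>\<close> tangent to the orbit.\<close>
    then obtain \<sigma> \<tau> where \<sigma>\<tau>: "(\<chi> i. g i) = \<sigma> + \<tau>" "\<sigma> \<in> module.span kscale_vec (set gs)" "\<tau> \<in> tangent_contact f"
      by (auto elim!: set_plus_elim)
    have "module (kscale_vec :: 'k \<Rightarrow> ('k, 'n) mps ^ 'n \<Rightarrow> _)"
      using vector_space_kscale_vec by (simp add: module_iff_vector_space)
    then obtain t0 where t0: "\<sigma> = (\<Sum>j<length gs. kscale_vec (t0 j) (gs ! j))"
      using module_span_list \<sigma>\<tau>(2) by blast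
    \<comment> \<open>Cutting off \<open>t0\<close> beyond the list puts the direction into
      \<open>affine_space\<close> and leaves the sum unchanged.\<close>
    define t where "t j = (if j < length gs then t0 j else 0)" for j
    have t: "\<sigma> = (\<Sum>j<length gs. kscale_vec (t j) (gs ! j))" "t \<in> affine_space (length gs)"
      by (auto simp: t0 t_def affine_space_def)
    obtain A B where \<tau>: "\<And>i. ord_ge ?D (\<tau> $ i)"
      and AB: "\<And>i x. hom_eval ?D (\<tau> $ i) x = (\<Sum>l\<in>UNIV. A i l * hom_eval ?D (f $ l) x) +
        (\<Sum>j\<in>UNIV. \<Sum>k\<in>UNIV. B j k * x k * hom_eval d (mps_deriv j (f $ i)) x)"
      using tangent_contact_leading_form[OF f \<sigma>\<tau>(3)] by blast
    have \<sigma>_eq: "\<sigma> $ i = g i - \<tau> $ i" for i using \<sigma>\<tau>(1) by (simp add: vec_eq_iff)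
    then have \<sigma>: "ord_ge ?D (\<sigma> $ i)" for i using g(1) \<tau> by (simp add: ord_ge_diff)
    define F where "F s = unfolding_at f gs (\<lambda>i. s * t i)" for s
    have F_comp: "F s $ i = f $ i + mps_const s * \<sigma> $ i" for s i
      by (simp add: F_def unfolding_at_line t(1))
    have F_ord: "ord_ge ?D (F s $ i)" for s i
      by (simp add: F_comp f \<sigma> ord_ge_add ord_ge_mult_left)
    have F_eval: "hom_eval ?D (F s $ i) x = hom_eval ?D (f $ i) x + s * hom_eval ?D (\<sigma> $ i) x" for s i x
      by (simp add: F_comp hom_eval_add hom_eval_mult_left \<sigma> mps_const.rep_eq)
    \<comment> \<open>The velocity of the point \<open>p\<close> under the substitution given by the
      identity plus \<open>s\<close> times \<open>B\<close>.\<close>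
    define w where "w p j = (\<Sum>k\<in>UNIV. B j k * p k)" for p j
    have "\<forall>lp. \<exists>q. (\<forall>s. poly q s = hom_eval ?D (f $ fst lp) (\<lambda>i. snd lp i + s * w (snd lp) i)) \<and>
        coeff q 0 = hom_eval ?D (f $ fst lp) (snd lp) \<and>
        coeff q 1 = (\<Sum>j\<in>UNIV. w (snd lp) j * hom_eval d (mps_deriv j (f $ fst lp)) (snd lp))"
      using hom_eval_line by blast
    from choice[OF this] obtain qf where qf: "\<And>l p s. poly (qf (l, p)) s = hom_eval ?D (f $ l) (\<lambda>i. p i + s * w p i)"
      "\<And>l p. coeff (qf (l, p)) 0 = hom_eval ?D (f $ l) p"
      "\<And>l p. coeff (qf (l, p)) 1 = (\<Sum>j\<in>UNIV. w p j * hom_eval d (mps_deriv j (f $ l)) p)"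
      by auto
    have "\<forall>lp. \<exists>q. (\<forall>s. poly q s = hom_eval ?D (\<sigma> $ fst lp) (\<lambda>i. snd lp i + s * w (snd lp) i)) \<and>
        coeff q 0 = hom_eval ?D (\<sigma> $ fst lp) (snd lp)"
      using hom_eval_line by blast
    from choice[OF this] obtain q\<sigma> where q\<sigma>: "\<And>l p s. poly (q\<sigma> (l, p)) s = hom_eval ?D (\<sigma> $ l) (\<lambda>i. p i + s * w p i)"
      "\<And>l p. coeff (q\<sigma> (l, p)) 0 = hom_eval ?D (\<sigma> $ l) p"
      by auto
    \<comment> \<open>The curve in coordinates: the leading form of \<open>F s\<close>, moved by the
      identity plus \<open>s\<close> times \<open>A\<close> on components and \<open>s\<close> times
      \<open>B\<close> on variables, minus the leading form of \<open>f\<close>.\<close>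
    define q where "q j = (\<Sum>l\<in>UNIV. [:if l = fst j then 1 else 0, A (fst j) l:] * (qf (l, snd j) + [:0, 1:] * q\<sigma> (l, snd j)))
        - [:hom_eval ?D (f $ fst j) (snd j):]" for j
    have q0: "coeff (q j) 0 = 0" for j
      by (simp add: q_def coeff_sum coeff_mult_0 qf(2) if_distrib[of "\<lambda>c. c * _"] cong: if_cong)
    \<comment> \<open>By the product rule the velocity at 0 has three parts: \<open>B\<close> and
      \<open>A\<close> together give the leading form of \<open>\<tau>\<close>, and the unfolding
      adds that of \<open>\<sigma>\<close>.\<close>
    have q1: "coeff (q (i, p)) 1 = v (i, p)" if "p \<in> P" for i p
    proof -
      have "coeff (q (i, p)) 1 = (\<Sum>l\<in>UNIV. (if l = i then 1 else 0) * (coeff (qf (l, p)) 1 + coeff (q\<sigma> (l, p)) 0) + A i l * hom_eval ?D (f $ l) p)"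
        unfolding q_def coeff_diff coeff_sum coeff_mult_1 coeff_add coeff_mult_0 qf(2) by simp
      also have "\<dots> = coeff (qf (i, p)) 1 + coeff (q\<sigma> (i, p)) 0 + (\<Sum>l\<in>UNIV. A i l * hom_eval ?D (f $ l) p)"
        by (simp add: sum.distrib if_distrib[of "\<lambda>c. c * _"] cong: if_cong)
      also have "\<dots> = hom_eval ?D (\<tau> $ i) p + hom_eval ?D (\<sigma> $ i) p"
        unfolding AB qf(3) q\<sigma>(2) w_def by (simp add: sum_distrib_right)
      also have "\<dots> = v (i, p)" using g(2)[OF that] by (simp add: \<sigma>_eq hom_eval_diff)
      finally show ?thesis .
    qed
    have zero: "(\<Sum>\<alpha>\<in>PiE J (\<lambda>_. {..E}). c \<alpha> * (\<Prod>j\<in>J. poly (q j) s ^ \<alpha> j)) = 0"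
      if sU: "(\<lambda>i. s * t i) \<in> U" for s
    proof -
      obtain h where h: "h \<in> H" "contact_equiv (F s) h" using cover[OF sU] unfolding F_def by blast
      obtain z where z: "\<And>i x. hom_eval ?D (F s $ i) x = lin_contact ?D h z i x"
        using contact_equiv_lin_contact[OF h(2) F_ord] by blast
      \<comment> \<open>The moving transformation is composed with the one relating
        \<open>F s\<close> to \<open>h\<close>. After normalization the point of the curve is a
        value of \<open>\<Phi> (h, jk)\<close>, where the relation holds.\<close>
      obtain z' where z': "\<And>i x. lin_contact ?D (F s) (\<lambda>(b, i, j). (if i = j then 1 else 0) + s * (if b then A i j else B i j)) i x
          = lin_contact ?D h z' i x"
        using lin_contact_compose[OF z] by blast
      obtain jk z'' where z'': "\<And>i x. lin_contact ?D h z' i x = lin_contact ?D h (z''((False, jk) := 1)) i x"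
        using lin_contact_normalized by blast
      have "poly (q j) s = \<Phi> (h, jk) j z''" for j
      proof -
        obtain i p where j: "j = (i, p)" by force
        have "(\<Sum>k\<in>UNIV. ((if j = k then 1 else 0) + s * B j k) * p k) = p j + s * w p j" for j
          by (simp add: w_def distrib_right sum.distrib sum_distrib_left mult.assoc if_distrib[of "\<lambda>c. c * _"] cong: if_cong)
        then have "lin_contact ?D h (z''((False, jk) := 1)) i p =
          (\<Sum>l\<in>UNIV. ((if i = l then 1 else 0) + s * A i l) * hom_eval ?D (F s $ l) (\<lambda>j. p j + s * w p j))"
          unfolding z''[symmetric] z'[symmetric] by (simp add: lin_contact_def)
        then show ?thesis
          by (simp add: q_def \<Phi>_def j poly_sum qf(1) q\<sigma>(1) F_eval eq_commute[of _ i] distrib_right[of _ "s * _"] mult.assoc)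
      qed
      then show ?thesis using rel[of "(h, jk)" z''] h(1) by (simp add: Q_def)
    qed
    have "UNIV - {s. (\<lambda>i. s * t i) \<notin> U} \<subseteq> {s. (\<Sum>\<alpha>\<in>PiE J (\<lambda>_. {..E}). c \<alpha> * (\<Prod>j\<in>J. poly (q j) s ^ \<alpha> j)) = 0}"
      using zero by blast
    moreover have "infinite (UNIV - {s. (\<lambda>i. s * t i) \<notin> U})"
      using zariski_open_line[OF U t(2)] inf by (rule Diff_infinite_finite)
    ultimately have "infinite {s. (\<Sum>\<alpha>\<in>PiE J (\<lambda>_. {..E}). c \<alpha> * (\<Prod>j\<in>J. poly (q j) s ^ \<alpha> j)) = 0}"
      using finite_subset by blast
    then show "\<exists>q. (\<forall>j\<in>J. coeff (q j) 0 = 0 \<and> coeff (q j) 1 = v j) \<and>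
        infinite {s. (\<Sum>\<alpha>\<in>PiE J (\<lambda>_. {..E}). c \<alpha> * (\<Prod>j\<in>J. poly (q j) s ^ \<alpha> j)) = 0}"
      using q0 q1 by (intro exI[of _ q]) (auto simp: J_def)
  qed
qed

section \<open>Counting monomials, and the two cases of the theorem\<close>

text \<open>The squares \<open>sq k\<close> and the products \<open>ind S\<close> of two distinct
  variables give \<open>n + n * (n - 1) div 2\<close> monomials, which is at least
  \<open>2 * n\<close> once \<open>n\<close> is at least 3.\<close>

lemma card_exps_2:
  assumes "3 \<le> CARD('n::finite)"
  shows "2 * CARD('n) \<le> card (exps 2 :: ('n \<Rightarrow> nat) set)"
proof -
  let ?n = "CARD('n)"
  define sq :: "'n \<Rightarrow> 'n \<Rightarrow> nat" where "sq k = (\<lambda>_. 0)(k := 2)" for k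
  define ind :: "'n set \<Rightarrow> 'n \<Rightarrow> nat" where "ind S i = (if i \<in> S then 1 else 0)" for S i
  let ?S = "{S :: 'n set. S \<subseteq> UNIV \<and> card S = 2}"
  have "inj sq"
  proof (rule injI)
    fix k l assume "sq k = sq l"
    then have "sq k k = sq l k" by simp
    then show "k = l" by (simp add: sq_def split: if_splits)
  qed
  moreover have "inj ind"
    by (rule injI) (auto simp: ind_def fun_eq_iff split: if_splits)
  moreover have "range sq \<inter> ind ` ?S = {}"
    by (auto simp: sq_def ind_def fun_eq_iff) (metis One_nat_def Suc_1 n_not_Suc_n zero_neq_numeral)
  ultimately have "card (range sq \<union> ind ` ?S) = ?n + card ?S"
    by (subst card_Un_disjoint) (auto simp: card_image inj_on_subset)
  also have "card ?S = ?n choose 2"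
    by (rule n_subsets) simp
  also have "?n choose 2 = ?n * (?n - 1) div 2" by (rule choose_two)
  finally have "card (range sq \<union> ind ` ?S) = ?n + ?n * (?n - 1) div 2" .
  moreover have "range sq \<union> ind ` ?S \<subseteq> exps 2"
    by (auto simp: exps_def sq_def ind_def sum_exponent_unit sum.If_cases)
  ultimately have "?n + ?n * (?n - 1) div 2 \<le> card (exps 2 :: ('n \<Rightarrow> nat) set)"
    using card_mono[OF finite_exps, of "range sq \<union> ind ` ?S" 2] by simp
  moreover have "?n * 2 \<le> ?n * (?n - 1)" using assms by (intro mult_le_mono2) auto
  ultimately show ?thesis by linarith
qed

text \<open>The four binary cubic monomials just reach the required number
  \<open>2 * 2\<close>.\<close>

lemma card_exps_3:
  assumes "CARD('n::finite) = 2"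
  shows "2 * CARD('n) \<le> card (exps 3 :: ('n \<Rightarrow> nat) set)"
proof -
  obtain a b :: 'n where ab: "a \<noteq> b" "(UNIV :: 'n set) = {a, b}"
    using assms by (auto simp: card_2_iff)
  define e :: "nat \<Rightarrow> 'n \<Rightarrow> nat" where "e k = (\<lambda>_. 3 - k)(a := k)" for k
  have "inj e" by (rule injI) (metis e_def fun_upd_same)
  then have "card (e ` {..3}) = 4" by (simp add: card_image inj_on_subset[OF _ subset_UNIV])
  moreover have "e ` {..3} \<subseteq> exps 3"
    unfolding exps_def e_def ab(2) using ab(1) by auto
  ultimately have "4 \<le> card (exps 3 :: ('n \<Rightarrow> nat) set)"
    using card_mono[OF finite_exps, of "e ` {..3}" 3] by simp
  then show ?thesis using assms by simp
qed

lemma ord_ge_component: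
  assumes "enat d \<le> vec_ord f"
  shows "ord_ge d (f $ i)"
  unfolding ord_ge_def
proof (intro allI impI, rule ccontr)
  fix e assume e: "sum e UNIV < d" "mps_coeff (f $ i) e \<noteq> 0"
  have "enat d \<le> mps_ord (f $ i)"
    using assms unfolding vec_ord_def by (rule order_trans) (auto intro: INF_lower)
  also have "\<dots> \<le> enat (sum e UNIV)"
    unfolding mps_ord_def using e(2) by (intro INF_lower) simp
  finally show False using e(1) by simp
qed

text \<open>The cases are regrouped by \<open>n\<close>. For \<open>n\<close> at least 3 either
  alternative gives order at least 2, and quadratic forms suffice; for \<open>n = 2\<close> only the
  first alternative remains, and cubic forms are used.\<close>

theorem theorem1p15:
  fixes f :: "('k::alg_closed_field, 'n::finite) mps ^ 'n"
  assumes "f \<in> ICIS"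
    and "(CARD('n) \<ge> 2 \<and> vec_ord f \<ge> 3) \<or> (CARD('n) \<ge> 3 \<and> vec_ord f = 2)"
  shows "\<not> simple f"
proof (cases "CARD('n) \<ge> 3")
  case True
  have "enat 2 \<le> vec_ord f"
    using assms(2) by (auto simp: numeral_eq_enat intro: order_trans[of _ "enat 3"])
  then have "ord_ge (Suc 1) (f $ i)" for i
    using ord_ge_component[of 2 f i] by (simp add: numeral_2_eq_2)
  moreover have "2 * CARD('n) \<le> card (exps (Suc 1) :: ('n \<Rightarrow> nat) set)"
    using card_exps_2[OF True] by (simp add: numeral_2_eq_2)
  ultimately show ?thesis by (rule infinitely_many_leading_forms[OF alg_closed_field_infinite])
next
  case False
  then have n: "CARD('n) = 2" and "enat 3 \<le> vec_ord f"
    using assms(2) by (auto simp: numeral_eq_enat)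
  then have "ord_ge (Suc 2) (f $ i)" for i
    using ord_ge_component[of 3 f i] by (simp add: eval_nat_numeral)
  moreover have "2 * CARD('n) \<le> card (exps (Suc 2) :: ('n \<Rightarrow> nat) set)"
    using card_exps_3[OF n] by (simp add: eval_nat_numeral)
  ultimately show ?thesis by (rule infinitely_many_leading_forms[OF alg_closed_field_infinite])
qed

end
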